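(* Let $p$ be an odd prime. Every indecomposable Schurian $p$-S-ring $\mathcal A$ over the group $H\cong\mathbb{Z}_p^4$ is $\simeq$-minimal, i.e. the only subgroup $X\le\mathrm{Sym}(H)$ with $H_R\le X$ having the same orbits on $H\times H$ as $\mathrm{Aut}(\mathcal A)$ is $X=\mathrm{Aut}(\mathcal A)$.
   Context: $H$ is written additively; $h_R$ is the translation $x\mapsto x+h$ and $H_R=\{h_R:h\in H\}$. $\mathrm{Cay}(H,S)$ is the digraph on $H$ with arcs $(x,x+s)$, $s\in S$. An S-ring over $H$ is a subalgebra $\mathcal A\subseteq\mathbb{Q}H$ spanned by $\underline{T}=\sum_{t\in T}t$ for $T$ in a partition $\mathrm{Bs}(\mathcal A)$ of $H$ (basic sets) with $\{0\}\in\mathrm{Bs}(\mathcal A)$ and $-T\in\mathrm{Bs}(\mathcal A)$ for all $T\in\mathrm{Bs}(\mathcal A)$. A subgroup $K\le H$ is an $\mathcal A$-subgroup if $\underline K\in\mathcal A$; $\mathrm{rad}(S)=\{h\in H:h+S=S\}$. $\mathcal A$ is a $p$-S-ring if all basic sets have $p$-power size. $\mathrm{Aut}(\mathcal A)=\bigcap_{T\in\mathrm{Bs}(\mathcal A)}\mathrm{Aut}(\mathrm{Cay}(H,T))$. $\mathcal A$ is Schurian if its basic sets are the orbits of $G_0$ (stabilizer of $0$) for some $G\le\mathrm{Sym}(H)$ with $H_R\le G$. If $F\le E$ are $\mathcal A$-subgroups with $F\le\mathrm{rad}(T)$ for every basic set $T\subseteq H\setminus E$, then $\mathcal A$ is an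 $E/F$-wreath product; $\mathcal A$ is decomposable if it is an $E/F$-wreath product for some such $E\ne H$, $F\ne\{0\}$, and indecomposable otherwise. *)

theory Defs
  imports Complex_Main "HOL-Computational_Algebra.Primes"
begin

definition nsmul :: "nat \<Rightarrow> 'h::ab_group_add \<Rightarrow> 'h" where
  "nsmul n x = (\<Sum>i<n. x)"

definition elem_abelian_rank4 :: "nat \<Rightarrow> 'h::{ab_group_add,finite} itself \<Rightarrow> bool" where
  "elem_abelian_rank4 p _ \<longleftrightarrow> card (UNIV :: 'h set) = p ^ 4 \<and> (\<forall>x::'h. nsmul p x = 0)"

(* group ring QH realised as functions H -> Q, with convolution product *)
definition conv :: "('h::{ab_group_add,finite} \<Rightarrow> rat) \<Rightarrow> ('h \<Rightarrow> rat) \<Rightarrow> 'h \<Rightarrow> rat" where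
  "conv f g h = (\<Sum>x\<in>UNIV. f x * g (h - x))"

(* the Q-span of the elements \<underline>T, T in Bs (Bs a partition of H):
   exactly the functions constant on each block *)
definition span_bs :: "'h set set \<Rightarrow> ('h \<Rightarrow> rat) set" where
  "span_bs Bs = {f. \<forall>T\<in>Bs. \<forall>x\<in>T. \<forall>y\<in>T. f x = f y}"

definition is_partition :: "'h set set \<Rightarrow> bool" where
  "is_partition Bs \<longleftrightarrow> (\<forall>T\<in>Bs. T \<noteq> {}) \<and> \<Union>Bs = UNIV \<and>
     (\<forall>S\<in>Bs. \<forall>T\<in>Bs. S \<noteq> T \<longrightarrow> S \<inter> T = {})"

(* S-ring over H, given by its set of basic sets *)
definition is_sring :: "'h::{ab_group_add,finite} set set \<Rightarrow> bool" where
  "is_sring Bs \<longleftrightarrow> is_partition Bs \<and> {0} \<in> Bs \<and> (\<forall>T\<in>Bs. uminus ` T \<in> Bs) \<and>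
     (\<forall>f\<in>span_bs Bs. \<forall>g\<in>span_bs Bs. conv f g \<in> span_bs Bs)"

definition is_p_sring :: "nat \<Rightarrow> 'h::{ab_group_add,finite} set set \<Rightarrow> bool" where
  "is_p_sring p Bs \<longleftrightarrow> is_sring Bs \<and> (\<forall>T\<in>Bs. \<exists>k. card T = p ^ k)"

definition is_subgroup :: "'h::ab_group_add set \<Rightarrow> bool" where
  "is_subgroup K \<longleftrightarrow> 0 \<in> K \<and> (\<forall>x\<in>K. \<forall>y\<in>K. x + y \<in> K) \<and> (\<forall>x\<in>K. - x \<in> K)"

definition A_subgroup :: "'h::{ab_group_add,finite} set set \<Rightarrow> 'h set \<Rightarrow> bool" where
  "A_subgroup Bs K \<longleftrightarrow> is_subgroup K \<and> (\<lambda>x. if x \<in> K then (1::rat) else 0) \<in> span_bs Bs"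

definition rad :: "'h::ab_group_add set \<Rightarrow> 'h set" where
  "rad S = {h. (\<lambda>s. h + s) ` S = S}"

definition is_wreath :: "'h::{ab_group_add,finite} set set \<Rightarrow> 'h set \<Rightarrow> 'h set \<Rightarrow> bool" where
  "is_wreath Bs E F \<longleftrightarrow> A_subgroup Bs E \<and> A_subgroup Bs F \<and> F \<subseteq> E \<and>
     (\<forall>T\<in>Bs. T \<subseteq> UNIV - E \<longrightarrow> F \<subseteq> rad T)"

definition decomposable :: "'h::{ab_group_add,finite} set set \<Rightarrow> bool" where
  "decomposable Bs \<longleftrightarrow> (\<exists>E F. is_wreath Bs E F \<and> E \<noteq> UNIV \<and> F \<noteq> {0})"

definition is_perm_group :: "('h \<Rightarrow> 'h) set \<Rightarrow> bool" where
  "is_perm_group X \<longleftrightarrow> (\<forall>g\<in>X. bij g) \<and> id \<in> X \<and>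
     (\<forall>g\<in>X. \<forall>h\<in>X. g \<circ> h \<in> X) \<and> (\<forall>g\<in>X. inv g \<in> X)"

definition contains_translations :: "('h::ab_group_add \<Rightarrow> 'h) set \<Rightarrow> bool" where
  "contains_translations X \<longleftrightarrow> (\<forall>h. (\<lambda>x. x + h) \<in> X)"

definition aut_cay :: "'h::ab_group_add set \<Rightarrow> ('h \<Rightarrow> 'h) set" where
  "aut_cay T = {g. bij g \<and> (\<forall>x y. y - x \<in> T \<longleftrightarrow> g y - g x \<in> T)}"

definition Aut_sring :: "'h::{ab_group_add,finite} set set \<Rightarrow> ('h \<Rightarrow> 'h) set" where
  "Aut_sring Bs = (\<Inter>T\<in>Bs. aut_cay T)"

definition schurian :: "'h::{ab_group_add,finite} set set \<Rightarrow> bool" where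
  "schurian Bs \<longleftrightarrow> (\<exists>G. is_perm_group G \<and> contains_translations G \<and>
     Bs = range (\<lambda>x. {g x | g. g \<in> G \<and> g 0 = 0}))"

definition orbits2 :: "('h \<Rightarrow> 'h) set \<Rightarrow> ('h \<times> 'h) set set" where
  "orbits2 X = range (\<lambda>(x, y). {(g x, g y) | g. g \<in> X})"

definition simeq_minimal :: "'h::{ab_group_add,finite} set set \<Rightarrow> bool" where
  "simeq_minimal Bs \<longleftrightarrow> (\<forall>X. is_perm_group X \<and> contains_translations X \<and>
     orbits2 X = orbits2 (Aut_sring Bs) \<longrightarrow> X = Aut_sring Bs)"

end

theory Submission
  imports Defs "HOL-Library.Poly_Mapping"
begin

text \<open>
  Let \<open>G = Aut(A)\<close>. It suffices to find a point \<open>x\<close> such that only the identity of \<open>G\<close> fixes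
  \<open>0\<close> and \<open>x\<close>: an element of \<open>G\<close> is then determined by its values at \<open>0\<close> and \<open>x\<close>, and every
  group with the same orbits on pairs contains an element with these values.

  Call \<open>z\<close> thin over an \<open>A\<close>-subgroup \<open>K\<close> if the stabilizer of \<open>0\<close> maps \<open>z\<close> into \<open>z + K\<close>; counting
  modulo \<open>p\<close> gives such a \<open>z\<close> outside \<open>K\<close> whenever \<open>K \<noteq> H\<close>. Let \<open>Z\<close> be the group of elements that are thin
  over \<open>0\<close>. If \<open>|Z| = p^3\<close>, the ring is decomposable. If \<open>|Z| = p^2\<close> and \<open>H/Z\<close> is thin,
  \<open>G\<close> acts on the cosets of \<open>Z\<close> by translations; indecomposability yields three cosets whose translation groups
  are distinct lines of \<open>Z\<close>, and this rigidifies \<open>G\<close>. If \<open>|Z| = p^2\<close> and \<open>H/Z\<close> is not thin, Schur's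
  theorem on multipliers yields a basic set that is a transversal of \<open>Z\<close> in a coset of a maximal
  \<open>A\<close>-subgroup \<open>E\<close>. If \<open>|Z| = p\<close>, there is a basic set \<open>T\<close> with trivial radical outside a maximal \<open>E\<close>,
  and \<open>|T|\<close> is \<open>p\<close> or \<open>p^2\<close>. For \<open>|T| = p\<close> the stabilizer of a point of \<open>T\<close> fixes the group generated
  by \<open>T - T\<close> pointwise. For \<open>|T| = p^2\<close> the set \<open>T\<close> is the graph of a function \<open>E/Z \<rightarrow> Z\<close>, and
  comparing its increments shows that the stabilizer of a point of \<open>T\<close> fixes \<open>E\<close> pointwise.
\<close>

section \<open>Subgroups of an elementary abelian group\<close>

lemma subgroup_zero: "is_subgroup K \<Longrightarrow> 0 \<in> K"
  and subgroup_add: "is_subgroup K \<Longrightarrow> x \<in> K \<Longrightarrow> y \<in> K \<Longrightarrow> x + y \<in> K"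
  and subgroup_minus: "is_subgroup K \<Longrightarrow> x \<in> K \<Longrightarrow> - x \<in> K"
  by (auto simp: is_subgroup_def)

lemma subgroup_diff: "is_subgroup K \<Longrightarrow> x \<in> K \<Longrightarrow> y \<in> K \<Longrightarrow> x - y \<in> K"
  using subgroup_add[of K x "- y"] subgroup_minus[of K y] by simp

lemma subgroup_Int: "is_subgroup K \<Longrightarrow> is_subgroup L \<Longrightarrow> is_subgroup (K \<inter> L)"
  by (auto simp: is_subgroup_def)

lemma subgroup_trivial: "is_subgroup {0}" and subgroup_UNIV: "is_subgroup UNIV"
  by (auto simp: is_subgroup_def)

lemma subgroup_add_cancel_right: "is_subgroup K \<Longrightarrow> y \<in> K \<Longrightarrow> x + y \<in> K \<longleftrightarrow> x \<in> K"
  using subgroup_diff[of K "x + y" y] subgroup_add[of K x y] by auto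

lemma subgroup_add_cancel_left: "is_subgroup K \<Longrightarrow> x \<in> K \<Longrightarrow> x + y \<in> K \<longleftrightarrow> y \<in> K"
  using subgroup_add_cancel_right[of K x y] by (simp add: add.commute)

lemma subgroup_diff_commute: "is_subgroup K \<Longrightarrow> x - y \<in> K \<longleftrightarrow> y - x \<in> K"
  using subgroup_minus[of K "x - y"] subgroup_minus[of K "y - x"] by auto

lemma card_translate: "card ((\<lambda>k. a + k) ` K) = card K" for a :: "'a::ab_group_add"
  by (rule card_image) auto

text \<open>Such an \<open>A\<close> is a disjoint union of cosets of \<open>K\<close>, each of size
  \<open>card K\<close>.\<close>

lemma card_dvd_of_invariant:
  fixes K A :: "'a::{ab_group_add,finite} set"
  assumes K: "is_subgroup K" and A: "\<And>a k. a \<in> A \<Longrightarrow> k \<in> K \<Longrightarrow> a + k \<in> A"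
  shows "card K dvd card A"
proof -
  let ?C = "(\<lambda>a. (\<lambda>k. a + k) ` K) ` A"
  have A_eq: "\<Union>?C = A"
    using A subgroup_zero[OF K] by force
  have coset: "(\<lambda>k. a + k) ` K = {x. x - a \<in> K}" for a
    by (force simp: image_iff algebra_simps)
  have "card K dvd card (\<Union>?C)"
  proof (rule dvd_partition)
    show "\<forall>c1\<in>?C. \<forall>c2\<in>?C. c1 \<noteq> c2 \<longrightarrow> c1 \<inter> c2 = {}"
    proof (intro ballI impI)
      fix c1 c2 assume "c1 \<in> ?C" "c2 \<in> ?C" "c1 \<noteq> c2"
      then obtain a b where c: "c1 = {x. x - a \<in> K}" "c2 = {x. x - b \<in> K}"
        unfolding coset by blast
      show "c1 \<inter> c2 = {}"
      proof (rule ccontr)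
        assume "c1 \<inter> c2 \<noteq> {}"
        then obtain x where x: "x - a \<in> K" "x - b \<in> K" unfolding c by blast
        have ab: "a - b \<in> K" using subgroup_diff[OF K x(2) x(1)] by simp
        have "y - a \<in> K \<longleftrightarrow> y - b \<in> K" for y
          using subgroup_add_cancel_right[OF K ab, of "y - a"] by simp
        then show False using \<open>c1 \<noteq> c2\<close> c by simp
      qed
    qed
  qed (auto simp: card_translate)
  then show ?thesis by (simp add: A_eq)
qed

lemma card_subgroup_dvd:
  fixes K L :: "'a::{ab_group_add,finite} set"
  assumes "is_subgroup K" "is_subgroup L" "K \<subseteq> L"
  shows "card K dvd card L"
  using assms by (intro card_dvd_of_invariant) (auto intro: subgroup_add)

section \<open>Multiples, and subgroups of \<open>p\<close>-power order\<close>

lemma nsmul_0 [simp]: "nsmul 0 x = 0" and nsmul_Suc: "nsmul (Suc n) x = nsmul n x + x"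
  by (auto simp: nsmul_def add.commute)

lemma nsmul_1 [simp]: "nsmul (Suc 0) x = x"
  by (simp add: nsmul_Suc)

lemma nsmul_add: "nsmul (m + n) x = nsmul m x + nsmul n x"
  by (induction n) (auto simp: nsmul_Suc algebra_simps)

lemma nsmul_mult: "nsmul (m * n) x = nsmul m (nsmul n x)"
  by (induction m) (auto simp: nsmul_Suc nsmul_add algebra_simps)

lemma nsmul_distrib: "nsmul m (x + y) = nsmul m x + nsmul m y"
  by (induction m) (auto simp: nsmul_Suc algebra_simps)

lemma nsmul_zero_right [simp]: "nsmul m 0 = 0"
  by (induction m) (auto simp: nsmul_Suc)

lemma nsmul_closed:
  assumes "0 \<in> S" "\<And>x y. x \<in> S \<Longrightarrow> y \<in> S \<Longrightarrow> x + y \<in> S" "x \<in> S"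
  shows "nsmul n x \<in> S"
  using assms by (induction n) (auto simp: nsmul_Suc)

locale rank4_group =
  fixes p :: nat and H :: "'h::{ab_group_add,finite} itself"
  assumes prime_p: "prime p" and rank4: "elem_abelian_rank4 p H"
begin

lemma card_H: "card (UNIV :: 'h set) = p ^ 4" and exponent: "nsmul p (x::'h) = 0"
  using rank4 by (auto simp: elem_abelian_rank4_def)

lemma p_gt_1: "p > 1"
  using prime_p prime_gt_1_nat by blast

text \<open>Negatives come for free: exponent \<open>p\<close> makes \<open>- x\<close> the multiple
  \<open>(p - 1) x\<close>.\<close>

lemma subgroupI:
  fixes S :: "'h set"
  assumes S: "0 \<in> S" "\<And>x y. x \<in> S \<Longrightarrow> y \<in> S \<Longrightarrow> x + y \<in> S"
  shows "is_subgroup S"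
proof -
  have "- x \<in> S" if x: "x \<in> S" for x
  proof -
    have "nsmul (p - 1) x + x = nsmul p x"
      using p_gt_1 by (simp add: nsmul_Suc[symmetric])
    then have "nsmul (p - 1) x = - x"
      by (simp add: exponent eq_neg_iff_add_eq_0)
    then show ?thesis using nsmul_closed[of S x "p - 1"] S x by auto
  qed
  then show ?thesis using S by (auto simp: is_subgroup_def)
qed

lemma nsmul_inverse:
  assumes "\<not> p dvd m"
  obtains n where "\<And>x::'h. nsmul n (nsmul m x) = x"
proof -
  have cop: "coprime m p" using prime_imp_coprime[OF prime_p assms] by (simp add: coprime_commute)
  have "m \<noteq> 0" using assms by (metis dvd_0_right)
  obtain n k where nk: "m * n = p * k + 1"
    using bezout_nat[OF \<open>m \<noteq> 0\<close>, of p] cop by auto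
  have "nsmul n (nsmul m x) = x" for x :: 'h
  proof -
    have "nsmul n (nsmul m x) = nsmul (k * p + 1) x"
      using nk by (simp add: nsmul_mult[symmetric] mult.commute)
    also have "\<dots> = x" by (simp add: nsmul_add nsmul_mult exponent nsmul_Suc)
    finally show ?thesis .
  qed
  then show ?thesis using that by blast
qed

lemma card_subgroup_power:
  fixes K :: "'h set"
  assumes "is_subgroup K"
  obtains i where "i \<le> 4" "card K = p ^ i"
proof -
  have "card K dvd p ^ 4"
    using card_subgroup_dvd[OF assms subgroup_UNIV] card_H by auto
  then show ?thesis using divides_primepow_nat[OF prime_p] that by blast
qed

lemma card_psubset_dvd:
  fixes K L :: "'h set"
  assumes "is_subgroup K" "is_subgroup L" "K \<subset> L"
  shows "p * card K dvd card L"
proof -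
  obtain i where i: "card K = p ^ i" using card_subgroup_power[OF assms(1)] by metis
  obtain j where j: "card L = p ^ j" using card_subgroup_power[OF assms(2)] by metis
  have "card K < card L" using assms(3) by (simp add: psubset_card_mono)
  then have "i < j" using i j p_gt_1 by (simp add: power_strict_increasing_iff)
  then have "p ^ Suc i dvd p ^ j" by (intro le_imp_power_dvd) simp
  then show ?thesis using i j by simp
qed

text \<open>Orders are powers of \<open>p\<close>, so a strictly larger subgroup has at least
  \<open>p\<close> times as many elements.\<close>

lemma subgroup_eq_of_card:
  fixes K M L :: "'h set"
  assumes "is_subgroup K" "is_subgroup M" "K \<subset> M" "M \<subseteq> L" "card L \<le> p * card K"
  shows "M = L"
proof -
  have "p * card K \<le> card M"
    using card_psubset_dvd[OF assms(1-3)] subgroup_zero[OF assms(2)]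
    by (intro dvd_imp_le) (auto simp: card_gt_0_iff)
  then show ?thesis using assms(4,5) by (simp add: card_seteq)
qed

lemma subgroup_Int_trivial:
  fixes K L :: "'h set"
  assumes "is_subgroup K" "is_subgroup L" "card K = p" "\<not> K \<subseteq> L"
  shows "K \<inter> L = {0}"
proof (rule ccontr)
  assume "K \<inter> L \<noteq> {0}"
  then have "{0} \<subset> K \<inter> L" using assms(1,2) by (auto simp: is_subgroup_def)
  then have "K \<inter> L = K"
    using assms by (intro subgroup_eq_of_card[of "{0}"] subgroup_Int subgroup_trivial) auto
  then show False using assms(4) by blast
qed

lemma double_eq_0:
  assumes "odd p" "(x::'h) + x = 0"
  shows "x = 0"
proof -
  have "p = Suc (p div 2 + p div 2)" using assms(1) by (metis Suc_eq_plus1 mult_2 odd_two_times_div_two_succ)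
  then have "nsmul p x = nsmul (p div 2) (x + x) + x"
    by (metis nsmul_Suc nsmul_add nsmul_distrib)
  then show ?thesis using assms(2) exponent[of x] by simp
qed

end

section \<open>Permutation groups containing the translations\<close>

locale transitive_extension =
  fixes G :: "('h::{ab_group_add,finite} \<Rightarrow> 'h) set"
  assumes perm: "is_perm_group G" and transl: "contains_translations G"
begin

definition stab :: "('h \<Rightarrow> 'h) set" where
  "stab = {g \<in> G. g 0 = 0}"

definition orb :: "'h \<Rightarrow> 'h set" where
  "orb x = {g x | g. g \<in> G \<and> g 0 = 0}"

definition invariant_subgroup :: "'h set \<Rightarrow> bool" where
  "invariant_subgroup K \<longleftrightarrow> is_subgroup K \<and> (\<forall>g\<in>stab. \<forall>x\<in>K. g x \<in> K)"

definition thin_over :: "'h set \<Rightarrow> 'h set" where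
  "thin_over K = {z. \<forall>g\<in>stab. g z - z \<in> K}"

lemma orb_iff: "y \<in> orb x \<longleftrightarrow> (\<exists>g\<in>stab. y = g x)"
  by (auto simp: orb_def stab_def)

lemma stab_in_G: "g \<in> stab \<Longrightarrow> g \<in> G" and stab_zero: "g \<in> stab \<Longrightarrow> g 0 = 0"
  by (auto simp: stab_def)

lemma bij_G: "g \<in> G \<Longrightarrow> bij g" and inv_G: "g \<in> G \<Longrightarrow> inv g \<in> G"
  and comp_G: "g \<in> G \<Longrightarrow> h \<in> G \<Longrightarrow> g \<circ> h \<in> G" and id_G: "id \<in> G"
  using perm by (auto simp: is_perm_group_def)

lemma inv_apply: "g \<in> G \<Longrightarrow> inv g (g x) = x" "g \<in> G \<Longrightarrow> g (inv g x) = x"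
  using bij_G[of g] by (auto simp: bij_def surj_f_inv_f)

lemma inv_stab:
  assumes "g \<in> stab"
  shows "inv g \<in> stab"
  using inv_apply(1)[of g 0] inv_G[of g] assms by (simp add: stab_def)

lemma comp_stab: "g \<in> stab \<Longrightarrow> h \<in> stab \<Longrightarrow> (\<lambda>x. g (h x)) \<in> stab"
  using comp_G[of g h] by (simp add: stab_def comp_def)

lemma id_stab: "(\<lambda>x. x) \<in> stab"
  using id_G by (auto simp: stab_def id_def)

lemma translation_G: "(\<lambda>x. x + a) \<in> G"
  using transl by (auto simp: contains_translations_def)

text \<open>Translations turn the behaviour of \<open>g\<close> around \<open>a\<close> into that of
  a stabilizer element around 0; this transfers facts about \<open>stab\<close> to all of
  \<open>G\<close>.\<close>

lemma conjugate_stab: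
  assumes "g \<in> G"
  shows "(\<lambda>u. g (u + a) - g a) \<in> stab"
proof -
  have "(\<lambda>x. x + (- g a)) \<circ> (g \<circ> (\<lambda>x. x + a)) \<in> G"
    using comp_G[OF translation_G comp_G[OF assms translation_G]] .
  then show ?thesis by (auto simp: stab_def comp_def)
qed

lemma orb_self: "x \<in> orb x"
  unfolding orb_iff by (rule bexI[OF _ id_stab]) simp

lemma stab_orb: "g \<in> stab \<Longrightarrow> g x \<in> orb x"
  unfolding orb_iff by (rule bexI) simp_all

lemma stab_closed_orb:
  assumes "g \<in> stab" "y \<in> orb x"
  shows "g y \<in> orb x"
proof -
  obtain h where h: "h \<in> stab" "y = h x" using assms(2) by (auto simp: orb_iff)
  show ?thesis using stab_orb[OF comp_stab[OF assms(1) h(1)], of x] h(2) by simp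
qed

lemma orb_eq:
  assumes "y \<in> orb x"
  shows "orb y = orb x"
proof -
  obtain g where g: "g \<in> stab" "y = g x" using assms by (auto simp: orb_iff)
  have x: "x \<in> orb y" using stab_orb[OF inv_stab[OF g(1)], of y] inv_apply(1)[OF stab_in_G[OF g(1)]] g(2) by simp
  have "orb a \<subseteq> orb b" if "a \<in> orb b" for a b
  proof
    fix z assume "z \<in> orb a"
    then obtain h where h: "h \<in> stab" "z = h a" unfolding orb_iff by auto
    show "z \<in> orb b" using stab_closed_orb[OF h(1) that] h(2) by simp
  qed
  from this[OF x] this[OF assms] show ?thesis by (rule equalityI[rotated])
qed

lemma diff_in_orb: "g \<in> G \<Longrightarrow> g w - g y \<in> orb (w - y)"
  using stab_orb[OF conjugate_stab[of g y], of "w - y"] by simp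

lemma orb_diff_eq: "g \<in> G \<Longrightarrow> orb (g w - g y) = orb (w - y)"
  by (rule orb_eq[OF diff_in_orb])

lemma in_orb_iff: "y \<in> orb x \<longleftrightarrow> orb y = orb x"
  using orb_eq orb_self by blast

lemma diff_orb_iff: "g \<in> G \<Longrightarrow> g w - g y \<in> orb x \<longleftrightarrow> w - y \<in> orb x"
  by (simp only: in_orb_iff orb_diff_eq[of g])

lemma orb_minusI:
  assumes "y \<in> orb x"
  shows "- y \<in> orb (- x)"
proof -
  obtain g where g: "g \<in> stab" "y = g x" using assms by (auto simp: orb_iff)
  show ?thesis using diff_in_orb[OF stab_in_G[OF g(1)], of 0 x] stab_zero[OF g(1)] g(2) by simp
qed

lemma invariant_subgroupD: "invariant_subgroup K \<Longrightarrow> is_subgroup K"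
  by (simp add: invariant_subgroup_def)

lemma invariant_subgroup_orb: "invariant_subgroup K \<Longrightarrow> x \<in> K \<Longrightarrow> orb x \<subseteq> K"
  by (auto simp: invariant_subgroup_def orb_iff)

text \<open>Membership of a difference in \<open>K\<close> depends only on its orbit, so the cosets
  of \<open>K\<close> are blocks of \<open>G\<close>.\<close>

lemma invariant_diff_iff:
  assumes "invariant_subgroup K" "g \<in> G"
  shows "g w - g y \<in> K \<longleftrightarrow> w - y \<in> K"
proof -
  have "a \<in> K" if "orb a = orb b" "b \<in> K" for a b
    using invariant_subgroup_orb[OF assms(1) that(2)] orb_self[of a] that(1) by auto
  from this[of "g w - g y" "w - y"] this[of "w - y" "g w - g y"] show ?thesis
    using orb_diff_eq[OF assms(2), of w y] by argo
qed

lemma invariant_trivial: "invariant_subgroup {0}"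
  by (auto simp: invariant_subgroup_def subgroup_trivial stab_zero)

lemma invariant_UNIV: "invariant_subgroup UNIV"
  by (auto simp: invariant_subgroup_def subgroup_UNIV)

lemma invariant_Int:
  "invariant_subgroup K \<Longrightarrow> invariant_subgroup L \<Longrightarrow> invariant_subgroup (K \<inter> L)"
  by (auto simp: invariant_subgroup_def subgroup_Int)

lemma thin_over_stab: "z \<in> thin_over K \<Longrightarrow> g \<in> stab \<Longrightarrow> g z - z \<in> K"
  by (auto simp: thin_over_def)

text \<open>Modulo \<open>K\<close>, every \<open>g\<close> commutes with the translation by a thin
  \<open>z\<close>.\<close>

lemma thin_overD:
  assumes "z \<in> thin_over K" "g \<in> G"
  shows "g (y + z) - g y - z \<in> K"
  using thin_over_stab[OF assms(1) conjugate_stab[OF assms(2), of y]] by (simp add: add.commute)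

lemma thin_trivial: "z \<in> thin_over {0} \<Longrightarrow> g \<in> G \<Longrightarrow> g (y + z) = g y + z"
  using thin_overD[of z "{0}" g y] by (simp add: diff_diff_eq)

lemma thin_over_superset:
  assumes "invariant_subgroup K"
  shows "K \<subseteq> thin_over K"
  using assms subgroup_diff[of K] by (auto simp: thin_over_def invariant_subgroup_def)

lemma thin_over_orb:
  assumes "invariant_subgroup K" "x \<in> thin_over K" "y \<in> orb x"
  shows "y - x \<in> K"
  using assms by (auto simp: thin_over_def orb_iff)

lemma subgroup_thin_over:
  assumes K: "invariant_subgroup K"
  shows "is_subgroup (thin_over K)"
proof -
  note sg = invariant_subgroupD[OF K]
  have add: "g (x + y) - (x + y) \<in> K" if "x \<in> thin_over K" "y \<in> thin_over K" "g \<in> stab" for x y g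
  proof -
    have "(g (x + y) - g x - y) + (g x - x) \<in> K"
      using thin_overD[OF that(2) stab_in_G[OF that(3)]] thin_over_stab[OF that(1,3)]
      by (rule subgroup_add[OF sg])
    then show ?thesis by (simp add: diff_diff_eq add.commute)
  qed
  have minus: "g (- x) - (- x) \<in> K" if "x \<in> thin_over K" "g \<in> stab" for x g
    using subgroup_minus[OF sg thin_overD[OF that(1) stab_in_G[OF that(2)], of "- x"]] stab_zero[OF that(2)]
    by (simp add: add.commute)
  show ?thesis unfolding is_subgroup_def
    using add minus subgroup_zero[OF sg] by (auto simp: thin_over_def stab_zero)
qed

text \<open>Since \<open>g z - z \<in> K\<close> for \<open>z\<close> thin over \<open>K\<close>, invariance is automatic between
  \<open>K\<close> and \<open>thin_over K\<close>.\<close>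

lemma invariant_between:
  assumes K: "invariant_subgroup K" and L: "is_subgroup L" "K \<subseteq> L" "L \<subseteq> thin_over K"
  shows "invariant_subgroup L"
proof -
  have "g x \<in> L" if "g \<in> stab" "x \<in> L" for g x
  proof -
    have "x \<in> thin_over K" using that(2) L(3) by blast
    then have "g x - x \<in> L" using thin_over_stab[OF _ that(1)] L(2) by blast
    then have "g x - x + x \<in> L" by (rule subgroup_add[OF L(1) _ that(2)])
    then show ?thesis by simp
  qed
  then show ?thesis using L(1) by (simp add: invariant_subgroup_def)
qed

lemma invariant_thin_over: "invariant_subgroup K \<Longrightarrow> invariant_subgroup (thin_over K)"
  using invariant_between subgroup_thin_over thin_over_superset by blast

section \<open>Radicals, shifts and difference groups of orbits\<close>

lemma rad_iff: "d \<in> rad S \<longleftrightarrow> (\<forall>s\<in>S. s + d \<in> S)" for S :: "'h set"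
proof
  assume r: "\<forall>s\<in>S. s + d \<in> S"
  have "(\<lambda>s. d + s) ` S \<subseteq> S" using r by (auto simp: add.commute)
  then have "(\<lambda>s. d + s) ` S = S"
    by (intro card_subset_eq) (auto simp: card_translate)
  then show "d \<in> rad S" by (simp add: rad_def)
qed (auto simp: rad_def add.commute)

lemma subgroup_rad: "is_subgroup (rad S)" for S :: "'h set"
proof -
  have "- d \<in> rad S" if "d \<in> rad S" for d
  proof -
    have d: "(\<lambda>s. d + s) ` S = S" using that by (simp add: rad_def)
    have "s + (- d) \<in> S" if "s \<in> S" for s
    proof -
      obtain t where "t \<in> S" "s = d + t" using \<open>s \<in> S\<close> d by blast
      then show ?thesis by simp
    qed
    then show ?thesis by (simp add: rad_iff)
  qed
  then show ?thesis by (auto simp: is_subgroup_def rad_iff add.assoc[symmetric])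
qed

lemma invariant_rad: "invariant_subgroup (rad (orb x))"
proof -
  have "g d \<in> rad (orb x)" if g: "g \<in> stab" and d: "d \<in> rad (orb x)" for g d
    unfolding rad_iff
  proof
    fix s assume s: "s \<in> orb x"
    \<comment> \<open>This preimage turns a shift by \<open>g d\<close> into a shift by
      \<open>d\<close>: \<open>?w - d\<close> has the same orbit as \<open>s\<close>.\<close>
    let ?w = "inv g (g d + s)"
    have gw: "g ?w = g d + s" by (rule inv_apply(2)[OF stab_in_G[OF g]])
    then have "g ?w - g d \<in> orb x" using s by simp
    then have "?w - d \<in> orb x" by (simp only: diff_orb_iff[OF stab_in_G[OF g]])
    then have "?w - d + d \<in> orb x" using d unfolding rad_iff by blast
    then have "g ?w \<in> orb x" using stab_closed_orb[OF g] by simp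
    then show "s + g d \<in> orb x" unfolding gw by (simp add: add.commute)
  qed
  then show ?thesis by (auto simp: invariant_subgroup_def subgroup_rad)
qed

text \<open>Only displacements that are themselves thin over \<open>K\<close> are kept; this is what
  makes them closed under addition.\<close>

definition shifts :: "'h set \<Rightarrow> 'h \<Rightarrow> 'h set" where
  "shifts K x = {e \<in> thin_over K. \<exists>g\<in>stab. g x - x - e \<in> K}"

lemma shifts_iff: "e \<in> shifts K x \<longleftrightarrow> e \<in> thin_over K \<and> (\<exists>y\<in>orb x. y - x - e \<in> K)"
  unfolding shifts_def orb_def stab_def by auto

lemma shifts_superset:
  assumes "invariant_subgroup K"
  shows "K \<subseteq> shifts K x"
proof
  fix k assume k: "k \<in> K"
  have "x - x - k \<in> K" using subgroup_minus[OF invariant_subgroupD[OF assms] k] by simp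
  then show "k \<in> shifts K x"
    unfolding shifts_iff using thin_over_superset[OF assms] k by (intro conjI bexI[OF _ orb_self]) auto
qed

text \<open>If \<open>g\<close> and \<open>h\<close> realise \<open>e\<close> and \<open>e'\<close>,
  then \<open>g\<close> after \<open>h\<close> realises \<open>e + e'\<close>, because
  \<open>g\<close> commutes modulo \<open>K\<close> with adding the thin \<open>e'\<close>.\<close>

lemma shifts_add:
  assumes K: "invariant_subgroup K" and e: "e \<in> shifts K x" "e' \<in> shifts K x"
  shows "e + e' \<in> shifts K x"
proof -
  note sg = invariant_subgroupD[OF K]
  obtain g where g: "g \<in> stab" "g x - x - e \<in> K" using e by (auto simp: shifts_def)
  obtain h where h: "h \<in> stab" "h x - x - e' \<in> K" using e by (auto simp: shifts_def)
  have "g (h x) - g (x + e') \<in> K"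
    using h invariant_diff_iff[OF K stab_in_G[OF g(1)]] by (simp add: diff_diff_eq)
  moreover have "g (x + e') - g x - e' \<in> K"
    using e thin_overD stab_in_G[OF g(1)] by (auto simp: shifts_def)
  ultimately have "(g (h x) - g (x + e')) + (g (x + e') - g x - e') + (g x - x - e) \<in> K"
    using g subgroup_add[OF sg] by blast
  then have gh: "g (h x) - x - (e + e') \<in> K" by (simp add: algebra_simps)
  have thin: "e + e' \<in> thin_over K"
    using e subgroup_add[OF subgroup_thin_over[OF K]] by (auto simp: shifts_def)
  have orb: "g (h x) \<in> orb x"
    using stab_orb[OF comp_stab[OF g(1) h(1)]] .
  show ?thesis unfolding shifts_iff using thin gh orb by (intro conjI) (assumption, rule bexI[of _ "g (h x)"], assumption+)
qed

text \<open>If \<open>g\<close> fixes \<open>D\<close> pointwise and \<open>g w = w + d\<close>, comparing \<open>w\<close> with all points of \<open>D\<close>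
  shows that \<open>d\<close> is in the radical of \<open>orb x\<close>.\<close>

lemma fixes_coset:
  assumes D: "invariant_subgroup D" and g: "g \<in> G" "\<And>y. y \<in> D \<Longrightarrow> g y = y"
    and x: "x \<in> thin_over D" "rad (orb x) = {0}" and w: "w - x \<in> D"
  shows "g w = w"
proof -
  note sg = invariant_subgroupD[OF D]
  define d where "d = g w - w"
  have "s + d \<in> orb x" if s: "s \<in> orb x" for s
  proof -
    have "s - x \<in> D" using thin_over_orb[OF D x(1) s] .
    then have "w - s \<in> D" using subgroup_diff[OF sg w, of "s - x"] by simp
    then have "g w - (w - s) \<in> orb s" using diff_in_orb[OF g(1), of w "w - s"] g(2) by simp
    then show ?thesis using orb_eq[OF s] by (simp add: d_def algebra_simps)
  qed
  then have "d \<in> rad (orb x)" by (simp add: rad_iff)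
  then show ?thesis using x(2) by (simp add: d_def)
qed

text \<open>A device for spreading rigidity from \<open>D\<close>: once these \<open>x\<close>
  exhaust \<open>H\<close>, an element of \<open>G\<close> fixing \<open>D\<close> pointwise is the
  identity.\<close>

definition stable_shifts :: "'h set \<Rightarrow> 'h set" where
  "stable_shifts D = {x. \<forall>g\<in>G. (\<forall>y\<in>D. g y = y) \<longrightarrow> (\<forall>y\<in>D. g (y + x) = y + x)}"

lemma stable_shifts_superset: "is_subgroup D \<Longrightarrow> D \<subseteq> stable_shifts D"
  by (auto simp: stable_shifts_def intro: subgroup_add)

lemma stable_shiftsD:
  assumes "x \<in> stable_shifts D" "g \<in> G" "\<And>y. y \<in> D \<Longrightarrow> g y = y" "y \<in> D"
  shows "g (y + x) = y + x"
proof -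
  have "\<forall>y\<in>D. g y = y" using assms(3) by blast
  then have "\<forall>y\<in>D. g (y + x) = y + x" using assms(1,2) by (simp add: stable_shifts_def)
  then show ?thesis using assms(4) by (rule bspec)
qed

text \<open>Conjugating \<open>g\<close> by the translation by \<open>x\<close> gives
  \<open>h\<close>, which again fixes \<open>D\<close> pointwise since \<open>x\<close> is stable;
  the stability of \<open>x'\<close> is then applied to \<open>h\<close>.\<close>

lemma stable_shifts_add:
  assumes x: "x \<in> stable_shifts D" "x' \<in> stable_shifts D"
  shows "x + x' \<in> stable_shifts D"
  unfolding stable_shifts_def
proof (intro CollectI ballI impI)
  fix g y assume g: "g \<in> G" "\<forall>y\<in>D. g y = y" and y: "y \<in> D"
  define h where "h = (\<lambda>u. u + - x) \<circ> (g \<circ> (\<lambda>u. u + x))"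
  have h: "h \<in> G" unfolding h_def using comp_G[OF translation_G comp_G[OF g(1) translation_G]] .
  have "h u = u" if "u \<in> D" for u
    using stable_shiftsD[OF x(1) g(1) bspec[OF g(2)] that] by (simp add: h_def)
  from stable_shiftsD[OF x(2) h this y] have "h (y + x') = y + x'" .
  then have "g (y + x' + x) - x = y + x'" by (simp add: h_def)
  then have "g (y + x' + x) = y + x' + x" by (simp only: diff_eq_eq)
  then show "g (y + (x + x')) = y + (x + x')" by (simp add: ac_simps)
qed

lemma stable_shifts_UNIV:
  assumes "is_subgroup D" "stable_shifts D = UNIV" "g \<in> G" "\<And>y. y \<in> D \<Longrightarrow> g y = y"
  shows "g = id"
proof
  fix x
  have "x \<in> stable_shifts D" using assms(2) by simp
  from stable_shiftsD[OF this assms(3,4) subgroup_zero[OF assms(1)]]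
  have "g (0 + x) = 0 + x" .
  then show "g x = id x" by simp
qed

lemma stable_shiftsI:
  assumes "invariant_subgroup D" "x \<in> thin_over D" "rad (orb x) = {0}"
  shows "x \<in> stable_shifts D"
  unfolding stable_shifts_def
proof (intro CollectI ballI impI)
  fix g y assume g: "g \<in> G" "\<forall>y\<in>D. g y = y" and y: "y \<in> D"
  show "g (y + x) = y + x"
    using fixes_coset[OF assms(1) g(1) bspec[OF g(2)] assms(2,3), of "y + x"] y by simp
qed

text \<open>The group generated by \<open>T - T\<close>, built as a walk with steps alternately in
  \<open>T\<close> and \<open>- T\<close>, so that inductions can pass through the intermediate
  point \<open>y + t\<close>.\<close>

inductive_set difference_span :: "'h set \<Rightarrow> 'h set" for T where
  zero: "0 \<in> difference_span T"
| step: "y \<in> difference_span T \<Longrightarrow> t \<in> T \<Longrightarrow> t' \<in> T \<Longrightarrow> y + t - t' \<in> difference_span T"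

lemma difference_span_add:
  "y \<in> difference_span T \<Longrightarrow> x \<in> difference_span T \<Longrightarrow> x + y \<in> difference_span T"
proof (induction rule: difference_span.induct)
  case (step y t t')
  then show ?case using difference_span.step[of "x + y" T t t'] by (simp add: algebra_simps)
qed (simp add: difference_span.zero)

lemma difference_span_minus: "y \<in> difference_span T \<Longrightarrow> - y \<in> difference_span T"
proof (induction rule: difference_span.induct)
  case (step y t t')
  then show ?case using difference_span.step[of "- y" T t' t] by (simp add: algebra_simps)
qed (simp add: difference_span.zero)

lemma subgroup_difference_span: "is_subgroup (difference_span T)"
  by (auto simp: is_subgroup_def difference_span.zero difference_span_add difference_span_minus)

lemma invariant_difference_span: "invariant_subgroup (difference_span (orb x))"
proof -
  have "g y \<in> difference_span (orb x)" if g: "g \<in> stab" and "y \<in> difference_span (orb x)" for g y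
    using that(2)
  proof (induction rule: difference_span.induct)
    case (step y t t')
    have "g (y + t) - g y \<in> orb x"
      using diff_orb_iff[OF stab_in_G[OF g], of "y + t" y] step by simp
    moreover have "g (y + t) - g (y + t - t') \<in> orb x"
      using diff_orb_iff[OF stab_in_G[OF g], of "y + t" "y + t - t'"] step by simp
    ultimately have "g y + (g (y + t) - g y) - (g (y + t) - g (y + t - t')) \<in> difference_span (orb x)"
      using difference_span.step step by blast
    then show ?case by simp
  qed (use g in \<open>simp add: difference_span.zero stab_zero\<close>)
  then show ?thesis by (simp add: invariant_subgroup_def subgroup_difference_span)
qed

lemma difference_span_subset:
  assumes "is_subgroup L" "\<And>t t'. t \<in> T \<Longrightarrow> t' \<in> T \<Longrightarrow> t - t' \<in> L"
  shows "difference_span T \<subseteq> L"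
proof
  fix y assume "y \<in> difference_span T"
  then show "y \<in> L"
  proof (induction rule: difference_span.induct)
    case (step y t t')
    then show ?case using subgroup_add[OF assms(1), of y "t - t'"] assms(2) by (simp add: algebra_simps)
  qed (use subgroup_zero[OF assms(1)] in simp)
qed

end

section \<open>Orbits of prime power length\<close>

locale p_extension = transitive_extension G + rank4_group p "TYPE('h)"
  for G :: "('h::{ab_group_add,finite} \<Rightarrow> 'h) set" and p :: nat +
  assumes card_orb: "\<exists>k. card (orb x) = p ^ k"
begin

text \<open>The preimage in \<open>H\<close> of an orbit of the stabilizer on \<open>H / K\<close>;
  quotients are handled through such unions of cosets.\<close>

definition orb_mod :: "'h set \<Rightarrow> 'h \<Rightarrow> 'h set" where
  "orb_mod K x = {y. \<exists>t\<in>orb x. y - t \<in> K}"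

lemma orb_mod_superset: "is_subgroup K \<Longrightarrow> orb x \<subseteq> orb_mod K x"
  by (auto simp: orb_mod_def subgroup_zero intro!: bexI)

lemma card_orb_inter_coset:
  assumes K: "invariant_subgroup K" and t: "t \<in> orb x"
  shows "card {s \<in> orb x. s - t \<in> K} = card {s \<in> orb x. s - x \<in> K}"
proof -
  obtain g where g: "g \<in> stab" "t = g x" using t by (auto simp: orb_iff)
  note G = stab_in_G[OF g(1)]
  have "bij_betw g {s \<in> orb x. s - x \<in> K} {s \<in> orb x. s - t \<in> K}"
  proof (rule bij_betw_byWitness[where f' = "inv g"])
    show "g ` {s \<in> orb x. s - x \<in> K} \<subseteq> {s \<in> orb x. s - t \<in> K}"
    proof (rule image_subsetI)
      fix s assume s: "s \<in> {s \<in> orb x. s - x \<in> K}"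
      then show "g s \<in> {s \<in> orb x. s - t \<in> K}"
        using stab_closed_orb[OF g(1), of s x] invariant_diff_iff[OF K G, of s x] g(2) by simp
    qed
    show "inv g ` {s \<in> orb x. s - t \<in> K} \<subseteq> {s \<in> orb x. s - x \<in> K}"
    proof (rule image_subsetI)
      fix s assume s: "s \<in> {s \<in> orb x. s - t \<in> K}"
      have "g (inv g s) - g x \<in> K" using s g(2) inv_apply(2)[OF G, of s] by simp
      then have "inv g s - x \<in> K" by (simp only: invariant_diff_iff[OF K G])
      moreover have "inv g s \<in> orb x" using stab_closed_orb[OF inv_stab[OF g(1)], of s x] s by simp
      ultimately show "inv g s \<in> {s \<in> orb x. s - x \<in> K}" by simp
    qed
  qed (simp_all add: inv_apply[OF G])
  then show ?thesis by (simp add: bij_betw_same_card)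
qed

text \<open>Double counting of the pairs of \<open>t\<close> in the orbit and \<open>y\<close> in
  \<open>t + K\<close>; all cosets of \<open>K\<close> that meet the orbit meet it in equally many
  points.\<close>

lemma card_orb_mod_mult:
  assumes K: "invariant_subgroup K"
  shows "card {s \<in> orb x. s - x \<in> K} * card (orb_mod K x) = card K * card (orb x)"
proof -
  note sg = invariant_subgroupD[OF K]
  let ?R = "\<lambda>t y. y - t \<in> K"
  have "(\<Sum>t\<in>orb x. card {y \<in> orb_mod K x. ?R t y}) = (\<Sum>y\<in>orb_mod K x. card {t \<in> orb x. ?R t y})"
    using sum.swap_restrict[of "orb x" "orb_mod K x" "\<lambda>_ _. 1::nat" ?R] by simp
  moreover have "card {y \<in> orb_mod K x. ?R t y} = card K" if "t \<in> orb x" for t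
  proof -
    have "{y \<in> orb_mod K x. ?R t y} = (\<lambda>k. t + k) ` K"
      using that by (force simp: orb_mod_def image_iff algebra_simps)
    then show ?thesis by (simp add: card_translate)
  qed
  moreover have "card {t \<in> orb x. ?R t y} = card {s \<in> orb x. s - x \<in> K}" if y: "y \<in> orb_mod K x" for y
  proof -
    obtain t where t: "t \<in> orb x" "y - t \<in> K" using y by (auto simp: orb_mod_def)
    have "y - s \<in> K \<longleftrightarrow> s - t \<in> K" for s
      using subgroup_add_cancel_left[OF sg t(2), of "t - s"] subgroup_diff_commute[OF sg, of s t] by simp
    then show ?thesis using card_orb_inter_coset[OF K t(1)] by simp
  qed
  ultimately show ?thesis by (simp add: mult.commute)
qed

lemma card_orb_mod_power:
  assumes K: "invariant_subgroup K"
  obtains j where "card (orb_mod K x) = p ^ j"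
proof -
  obtain i where i: "card K = p ^ i" using card_subgroup_power[OF invariant_subgroupD[OF K]] by metis
  obtain k where k: "card (orb x) = p ^ k" using card_orb by blast
  have "card (orb_mod K x) dvd p ^ (i + k)"
    using card_orb_mod_mult[OF K, of x] i k by (metis dvd_triv_right power_add)
  then show ?thesis using divides_primepow_nat[OF prime_p] that by blast
qed

lemma orb_mod_eq:
  assumes K: "invariant_subgroup K" and "y \<in> orb_mod K a" "y \<in> orb_mod K b"
  shows "orb_mod K a \<subseteq> orb_mod K b"
proof
  note sg = invariant_subgroupD[OF K]
  obtain t s where ts: "t \<in> orb a" "y - t \<in> K" "s \<in> orb b" "y - s \<in> K"
    using assms(2,3) by (auto simp: orb_mod_def)
  have "t - s \<in> K" using subgroup_diff[OF sg ts(4,2)] by simp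
  fix z assume "z \<in> orb_mod K a"
  then obtain u where u: "u \<in> orb a" "z - u \<in> K" by (auto simp: orb_mod_def)
  have "u \<in> orb t" using orb_eq[OF ts(1)] u(1) by simp
  then obtain g where g: "g \<in> stab" "u = g t" by (auto simp: orb_iff)
  have "u - g s \<in> K" using invariant_diff_iff[OF K stab_in_G[OF g(1)], of t s] \<open>t - s \<in> K\<close> g(2) by simp
  from subgroup_add[OF sg u(2) this] have "z - g s \<in> K" by simp
  moreover have "g s \<in> orb b" using stab_closed_orb[OF g(1) ts(3)] .
  ultimately show "z \<in> orb_mod K b" by (auto simp: orb_mod_def)
qed

text \<open>The fixed point theorem for the action of a \<open>p\<close>-group on \<open>L / K\<close>, phrased in terms of orbit sizes.\<close>

lemma exists_thin_over:
  assumes K: "invariant_subgroup K" and L: "invariant_subgroup L" and KL: "K \<subset> L"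
  obtains z where "z \<in> L" "z \<notin> K" "z \<in> thin_over K"
proof (rule ccontr)
  assume no: "\<not> thesis"
  note thesis = that
  have not_thin: "z \<notin> thin_over K" if "z \<in> L" "z \<notin> K" for z using thesis[OF that] no by blast
  note sgK = invariant_subgroupD[OF K] and sgL = invariant_subgroupD[OF L]
  have sub: "orb_mod K z \<subseteq> L - K" if z: "z \<in> L - K" for z
  proof
    fix y assume "y \<in> orb_mod K z"
    then obtain t where t: "t \<in> orb z" "y - t \<in> K" by (auto simp: orb_mod_def)
    have "t \<in> L" using invariant_subgroup_orb[OF L, of z] z t(1) by auto
    moreover have "t \<notin> K"
    proof
      assume "t \<in> K"
      then have "orb z \<subseteq> K" using invariant_subgroup_orb[OF K] orb_eq[OF t(1)] by metis
      then show False using orb_self[of z] z by auto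
    qed
    ultimately show "y \<in> L - K"
      using t(2) KL subgroup_add[OF sgL, of "y - t" t] subgroup_diff[OF sgK, of y "y - t"] by auto
  qed
  have dvd: "p * card K dvd card (orb_mod K z)" if z: "z \<in> L - K" for z
  proof -
    obtain i where i: "card K = p ^ i" using card_subgroup_power[OF sgK] by metis
    obtain j where j: "card (orb_mod K z) = p ^ j" using card_orb_mod_power[OF K] .
    obtain g where g: "g \<in> stab" "g z - z \<notin> K" using not_thin z by (auto simp: thin_over_def)
    \<comment> \<open>A displacement outside \<open>K\<close> makes the orbit on
      \<open>H / K\<close> nontrivial, so its length, a power of \<open>p\<close>, is a multiple of
      \<open>p\<close>.\<close>
    have "(\<lambda>k. z + k) ` K \<subset> orb_mod K z"
    proof (rule psubsetI)
      show "(\<lambda>k. z + k) ` K \<subseteq> orb_mod K z"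
        unfolding orb_mod_def by (auto intro!: bexI[OF _ orb_self])
      have "g z \<in> orb_mod K z" using orb_mod_superset[OF sgK, of z] stab_orb[OF g(1), of z] by (rule subsetD)
      moreover have "g z \<notin> (\<lambda>k. z + k) ` K" using g(2) by auto
      ultimately show "(\<lambda>k. z + k) ` K \<noteq> orb_mod K z" by blast
    qed
    then have "card ((\<lambda>k. z + k) ` K) < card (orb_mod K z)" by (intro psubset_card_mono) auto
    then have "p ^ i < p ^ j" using i j by (simp add: card_translate)
    then have "Suc i \<le> j" using p_gt_1 by (simp add: power_strict_increasing_iff)
    then have "p ^ Suc i dvd p ^ j" by (rule le_imp_power_dvd)
    then show ?thesis using i j by simp
  qed
  have "p * card K dvd card (\<Union>(orb_mod K ` (L - K)))"
  proof (rule dvd_partition)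
    show "\<forall>c1\<in>orb_mod K ` (L - K). \<forall>c2\<in>orb_mod K ` (L - K). c1 \<noteq> c2 \<longrightarrow> c1 \<inter> c2 = {}"
    proof (intro ballI impI)
      fix c1 c2 assume "c1 \<in> orb_mod K ` (L - K)" "c2 \<in> orb_mod K ` (L - K)" and ne: "c1 \<noteq> c2"
      then obtain a b where "c1 = orb_mod K a" "c2 = orb_mod K b" by (elim imageE)
      then show "c1 \<inter> c2 = {}"
        using orb_mod_eq[OF K, of _ a b] orb_mod_eq[OF K, of _ b a] ne by auto
    qed
  qed (use dvd in auto)
  moreover have "\<Union>(orb_mod K ` (L - K)) = L - K"
  proof
    show "L - K \<subseteq> \<Union>(orb_mod K ` (L - K))"
    proof
      fix z assume z: "z \<in> L - K"
      have "z \<in> orb_mod K z" using orb_mod_superset[OF sgK, of z] orb_self[of z] by (rule subsetD)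
      then show "z \<in> \<Union>(orb_mod K ` (L - K))" using z by (rule UN_I[rotated])
    qed
  qed (intro UN_least sub)
  ultimately have "p * card K dvd card L - card K"
    using KL by (simp add: card_Diff_subset)
  moreover have "p * card K dvd card L" using card_psubset_dvd[OF sgK sgL KL] .
  moreover have "card K \<le> card L" using KL by (intro card_mono) auto
  ultimately have "p * card K dvd card K" by (meson dvd_diffD1)
  moreover have "0 < card K" using subgroup_zero[OF sgK] by (auto simp: card_gt_0_iff)
  ultimately show False using p_gt_1 by (auto dest: dvd_imp_le)
qed

lemma nontrivial_meets_thin:
  assumes "invariant_subgroup K" "K \<noteq> {0}"
  shows "K \<inter> thin_over {0} \<noteq> {0}"
proof -
  have "{0} \<subset> K" using assms subgroup_zero[OF invariant_subgroupD[OF assms(1)]] by auto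
  then obtain z where "z \<in> K" "z \<notin> {0}" "z \<in> thin_over {0}"
    using exists_thin_over[OF invariant_trivial assms(1)] by blast
  then show ?thesis by blast
qed

definition adjoin :: "'h set \<Rightarrow> 'h \<Rightarrow> 'h set" where
  "adjoin K z = {y. \<exists>m. y - nsmul m z \<in> K}"

lemma subgroup_adjoin:
  assumes K: "is_subgroup K"
  shows "is_subgroup (adjoin K z)"
proof (rule subgroupI)
  show "0 \<in> adjoin K z" using subgroup_zero[OF K] by (auto simp: adjoin_def intro!: exI[of _ 0])
  fix x y assume "x \<in> adjoin K z" "y \<in> adjoin K z"
  then obtain m n where "x - nsmul m z \<in> K" "y - nsmul n z \<in> K" by (auto simp: adjoin_def)
  from subgroup_add[OF K this] have "(x + y) - nsmul (m + n) z \<in> K"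
    by (simp add: nsmul_add algebra_simps)
  then show "x + y \<in> adjoin K z" by (auto simp: adjoin_def)
qed

lemma adjoin_superset: "K \<subseteq> adjoin K z"
  by (auto simp: adjoin_def intro!: exI[of _ 0])

lemma adjoin_self: "is_subgroup K \<Longrightarrow> z \<in> adjoin K z"
  by (auto simp: adjoin_def subgroup_zero intro!: exI[of _ "Suc 0"])

lemma adjoin_subset:
  assumes "is_subgroup L" "K \<subseteq> L" "z \<in> L"
  shows "adjoin K z \<subseteq> L"
proof
  fix y assume "y \<in> adjoin K z"
  then obtain m where "y - nsmul m z \<in> K" by (auto simp: adjoin_def)
  moreover have "nsmul m z \<in> L"
    using nsmul_closed[of L z m] assms subgroup_zero subgroup_add by blast
  ultimately have "y - nsmul m z + nsmul m z \<in> L" using assms subgroup_add by blast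
  then show "y \<in> L" by simp
qed

lemma card_adjoin_le: "card (adjoin K z) \<le> p * card K"
proof -
  have "adjoin K z \<subseteq> (\<Union>m<p. (\<lambda>k. nsmul m z + k) ` K)"
  proof
    fix y assume "y \<in> adjoin K z"
    then obtain m where m: "y - nsmul m z \<in> K" by (auto simp: adjoin_def)
    have "nsmul m z = nsmul ((m div p) * p + m mod p) z" by simp
    also have "\<dots> = nsmul (m mod p) z" by (simp only: nsmul_add nsmul_mult exponent) simp
    finally have "y \<in> (\<lambda>k. nsmul (m mod p) z + k) ` K"
      using m by (intro image_eqI[of _ _ "y - nsmul m z"]) auto
    moreover have "m mod p < p" using p_gt_1 by simp
    ultimately show "y \<in> (\<Union>m<p. (\<lambda>k. nsmul m z + k) ` K)" by blast
  qed
  then have "card (adjoin K z) \<le> card (\<Union>m<p. (\<lambda>k. nsmul m z + k) ` K)" by (intro card_mono) auto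
  also have "\<dots> \<le> (\<Sum>m<p. card ((\<lambda>k. nsmul m z + k) ` K))" by (rule card_UN_le) simp
  finally show ?thesis by (simp add: card_translate)
qed

text \<open>Take \<open>M\<close> of largest order among the proper invariant subgroups. Some point
  of \<open>L\<close> outside \<open>M\<close> is thin over \<open>M\<close>, so maximality makes
  all of \<open>L\<close> thin over \<open>M\<close>. Then every group in between is invariant,
  which forces index \<open>p\<close>.\<close>

lemma exists_maximal_invariant:
  assumes L: "invariant_subgroup L" "L \<noteq> {0}"
  obtains M where "invariant_subgroup M" "M \<subset> L" "L \<subseteq> thin_over M" "card L = p * card M"
proof -
  let ?S = "{M. invariant_subgroup M \<and> M \<subset> L}"
  note sgL = invariant_subgroupD[OF L(1)]
  have "{0} \<in> ?S" using L invariant_trivial subgroup_zero[OF sgL] by auto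
  then obtain M where M: "invariant_subgroup M" "M \<subset> L"
    and max: "\<And>N. invariant_subgroup N \<Longrightarrow> N \<subset> L \<Longrightarrow> card N \<le> card M"
    using ex_has_greatest_nat[of "\<lambda>M. M \<in> ?S" "{0}" card "Suc (card L)"]
    by (auto simp: less_Suc_eq_le card_mono psubset_imp_subset)
  note sgM = invariant_subgroupD[OF M(1)]
  have eq: "N = L" if "invariant_subgroup N" "M \<subset> N" "N \<subseteq> L" for N
    using max[OF that(1)] psubset_card_mono[OF _ that(2)] that(3) by fastforce
  obtain z where z: "z \<in> L" "z \<notin> M" "z \<in> thin_over M" using exists_thin_over[OF M(1) L(1) M(2)] .
  have "thin_over M \<inter> L = L"
    using eq[of "thin_over M \<inter> L"] invariant_Int[OF invariant_thin_over[OF M(1)] L(1)]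
      thin_over_superset[OF M(1)] M(2) z by blast
  then have thin: "L \<subseteq> thin_over M" by blast
  have sub: "adjoin M z \<subseteq> L" using adjoin_subset[OF sgL] M z by blast
  have "adjoin M z = L"
  proof (rule eq)
    show "invariant_subgroup (adjoin M z)"
      using invariant_between[OF M(1) subgroup_adjoin[OF sgM] adjoin_superset] sub thin by blast
    show "M \<subset> adjoin M z" using adjoin_superset adjoin_self[OF sgM] z(2) by blast
  qed fact
  then have "card L \<le> p * card M" using card_adjoin_le by metis
  moreover have "p * card M dvd card L" using card_psubset_dvd[OF sgM sgL M(2)] .
  moreover have "0 < card L" using subgroup_zero[OF sgL] by (auto simp: card_gt_0_iff)
  ultimately have "card L = p * card M" by (simp add: dvd_imp_le le_antisym)
  then show ?thesis using that M thin by blast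
qed

lemma card_eq_1_imp_eq: "card A = 1 \<Longrightarrow> a \<in> A \<Longrightarrow> b \<in> A \<Longrightarrow> a = b"
  by (metis card_1_singletonE singletonD)

text \<open>Let \<open>L\<close> be a smallest invariant subgroup containing all
  \<open>t - x\<close>, and \<open>M\<close> maximal invariant in \<open>L\<close>. The orbit is not
  inside \<open>x + M\<close>, so a coset of \<open>M\<close> that meets it does so in a power of
  \<open>p\<close> below \<open>p\<close>, that is, in one point. As \<open>t - x\<close> is thin
  over \<open>M\<close>, \<open>g\<close> keeps \<open>t\<close> in its coset and hence fixes
  it.\<close>

lemma prime_orb_fixed_stab:
  assumes x: "card (orb x) = p" and g: "g \<in> stab" "g x = x" and t: "t \<in> orb x"
  shows "g t = t"
proof -
  let ?S = "{L. invariant_subgroup L \<and> (\<forall>t\<in>orb x. t - x \<in> L)}"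
  have "UNIV \<in> ?S" using invariant_UNIV by auto
  then obtain L where L: "invariant_subgroup L" "\<And>t. t \<in> orb x \<Longrightarrow> t - x \<in> L"
    and min: "\<And>N. invariant_subgroup N \<Longrightarrow> (\<And>t. t \<in> orb x \<Longrightarrow> t - x \<in> N) \<Longrightarrow> card L \<le> card N"
    using ex_has_least_nat[of "\<lambda>L. L \<in> ?S" UNIV card] by auto
  have "L \<noteq> {0}"
  proof
    assume "L = {0}"
    then have "orb x \<subseteq> {x}" using L(2) by auto
    then have "card (orb x) \<le> 1" using card_mono[of "{x}" "orb x"] by simp
    then show False using x p_gt_1 by simp
  qed
  then obtain M where M: "invariant_subgroup M" "M \<subset> L" "L \<subseteq> thin_over M"
    using exists_maximal_invariant[OF L(1)] by metis
  have "\<exists>t\<in>orb x. t - x \<notin> M"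
    using min[OF M(1)] psubset_card_mono[OF _ M(2)] by fastforce
  then have "{s \<in> orb x. s - x \<in> M} \<subset> orb x" by blast
  then have less: "card {s \<in> orb x. s - x \<in> M} < p" using psubset_card_mono[of "orb x"] x by simp
  obtain i where i: "card M = p ^ i" using card_subgroup_power[OF invariant_subgroupD[OF M(1)]] by metis
  have "card {s \<in> orb x. s - x \<in> M} dvd p ^ Suc i"
    using card_orb_mod_mult[OF M(1), of x] i x by (metis dvd_triv_left power_Suc2)
  then obtain j where j: "card {s \<in> orb x. s - x \<in> M} = p ^ j"
    using divides_primepow_nat[OF prime_p] by blast
  have "j = 0"
  proof (rule ccontr)
    assume "j \<noteq> 0"
    then have "p ^ 1 \<le> p ^ j" using p_gt_1 by (intro power_increasing) auto
    then show False using less j by simp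
  qed
  then have one: "card {s \<in> orb x. s - t \<in> M} = 1"
    using card_orb_inter_coset[OF M(1) t] j by simp
  have "t - x \<in> thin_over M" using L(2)[OF t] M(3) by blast
  from thin_overD[OF this stab_in_G[OF g(1)], of x] have "g t - t \<in> M" using g(2) by simp
  then have "g t \<in> {s \<in> orb x. s - t \<in> M}" using stab_closed_orb[OF g(1) t] by simp
  moreover have "t \<in> {s \<in> orb x. s - t \<in> M}"
    using t subgroup_zero[OF invariant_subgroupD[OF M(1)]] by simp
  ultimately show ?thesis by (rule card_eq_1_imp_eq[OF one])
qed

lemma prime_orb_fixed:
  assumes x: "card (orb x) = p" and g: "g \<in> G" "g y = y" "g (y + t) = y + t"
    and t: "t \<in> orb x" "s \<in> orb x"
  shows "g (y + s) = y + s"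
proof -
  have "g (s + y) - g y = s"
    by (rule prime_orb_fixed_stab[OF _ conjugate_stab[OF g(1), of y], of t])
       (use g t x orb_eq[OF t(1)] in \<open>simp_all add: add.commute\<close>)
  then show ?thesis using g(2) by (simp add: diff_eq_eq add.commute)
qed

lemma orb_uminus: "orb (- x) = uminus ` orb x"
proof
  show "uminus ` orb x \<subseteq> orb (- x)" by (auto intro: orb_minusI)
  show "orb (- x) \<subseteq> uminus ` orb x"
  proof
    fix y assume "y \<in> orb (- x)"
    from orb_minusI[OF this] have "- y \<in> orb x" by simp
    then show "y \<in> uminus ` orb x" by force
  qed
qed

lemma difference_span_fixed:
  assumes x: "card (orb x) = p" and g: "g \<in> stab" "g x = x"
    and y: "y \<in> difference_span (orb x)"
  shows "g y = y"
proof -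
  note G = stab_in_G[OF g(1)]
  have card': "card (orb (- x)) = p" using x unfolding orb_uminus by (simp add: card_image)
  \<comment> \<open>The points \<open>y + t\<close> are carried along. Around \<open>y + t\<close>
    the fixed point \<open>y\<close> gives that \<open>y + t - t'\<close> is fixed; around the
    latter the fixed point \<open>y + t\<close> gives the rest.\<close>
  from y have "g y = y \<and> (\<forall>t\<in>orb x. g (y + t) = y + t)"
  proof (induction rule: difference_span.induct)
    case zero
    then show ?case using prime_orb_fixed_stab[OF x g] stab_zero[OF g(1)] by simp
  next
    case (step y t t')
    have w: "g (y + t) = y + t" using step by blast
    have "g (y + t + - t') = y + t + - t'"
      by (rule prime_orb_fixed[OF card' G w, of "- t"]) (use step in \<open>auto intro: orb_minusI\<close>)
    then have y': "g (y + t - t') = y + t - t'" by simp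
    have "g (y + t - t' + s) = y + t - t' + s" if "s \<in> orb x" for s
      by (rule prime_orb_fixed[OF x G y', of t']) (use step w that in auto)
    with y' show ?case by blast
  qed
  then show ?thesis by blast
qed

end

section \<open>Schur's theorem on multipliers\<close>

lemma prime_dvd_binomial_expansion:
  fixes a b :: "'a::comm_ring_1"
  assumes q: "prime q"
  shows "\<exists>r. (a + b) ^ q = a ^ q + b ^ q + of_nat q * r"
proof -
  have "\<exists>r. of_nat (q choose k) * a ^ k * b ^ (q - k) = of_nat q * r" if k: "k \<in> {0<..<q}" for k
  proof -
    have "q dvd (q choose k)" using k q by (intro dvd_choose_prime) auto
    then obtain c where "q choose k = q * c" by (elim dvdE)
    then have "of_nat (q choose k) * a ^ k * b ^ (q - k) = of_nat q * (of_nat c * a ^ k * b ^ (q - k))"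
      by (simp add: mult.assoc)
    then show ?thesis by blast
  qed
  then obtain r where r: "\<And>k. k \<in> {0<..<q} \<Longrightarrow> of_nat (q choose k) * a ^ k * b ^ (q - k) = of_nat q * r k"
    by metis
  have "q > 0" using q prime_gt_0_nat by blast
  have split: "{..q} = insert 0 (insert q {0<..<q})" using \<open>q > 0\<close> by auto
  have "(a + b) ^ q = (\<Sum>k\<le>q. of_nat (q choose k) * a ^ k * b ^ (q - k))"
    by (rule binomial_ring)
  also have "\<dots> = a ^ q + b ^ q + (\<Sum>k\<in>{0<..<q}. of_nat (q choose k) * a ^ k * b ^ (q - k))"
    using \<open>q > 0\<close> by (subst split) (simp add: ac_simps)
  also have "\<dots> = a ^ q + b ^ q + of_nat q * (\<Sum>k\<in>{0<..<q}. r k)"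
    unfolding sum_distrib_left by (intro arg_cong2[of _ _ _ _ "(+)"] refl sum.cong r)
  finally show ?thesis by blast
qed

lemma sum_power_prime:
  fixes f :: "'i \<Rightarrow> 'a::comm_ring_1"
  assumes q: "prime q"
  shows "\<exists>r. (\<Sum>t\<in>A. f t) ^ q = (\<Sum>t\<in>A. f t ^ q) + of_nat q * r"
proof (induction A rule: infinite_finite_induct)
  case (insert t A)
  then obtain r where r: "(\<Sum>t\<in>A. f t) ^ q = (\<Sum>t\<in>A. f t ^ q) + of_nat q * r" by blast
  obtain s where s: "(f t + (\<Sum>t\<in>A. f t)) ^ q = f t ^ q + (\<Sum>t\<in>A. f t) ^ q + of_nat q * s"
    using prime_dvd_binomial_expansion[OF q] by blast
  have "(\<Sum>t\<in>insert t A. f t) ^ q = (\<Sum>t\<in>insert t A. f t ^ q) + of_nat q * (r + s)"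
    using insert.hyps s r by (simp add: algebra_simps)
  then show ?case by blast
qed (use prime_gt_0_nat[OF q] in \<open>auto simp: power_0_left intro: exI[of _ 0]\<close>)

lemma lookup_times_finite:
  fixes f g :: "'h::{ab_group_add,finite} \<Rightarrow>\<^sub>0 int"
  shows "Poly_Mapping.lookup (f * g) k = (\<Sum>l\<in>UNIV. Poly_Mapping.lookup f l * Poly_Mapping.lookup g (k - l))"
proof -
  have "k = l + q \<longleftrightarrow> q = k - l" for l q :: 'h by (auto simp: algebra_simps)
  then have "(\<Sum>q. Poly_Mapping.lookup g q when k = l + q) = Poly_Mapping.lookup g (k - l)" for l
    by simp
  then show ?thesis
    by (simp add: times_poly_mapping.rep_eq prod_fun_def Sum_any.expand_superset[of UNIV])
qed

lemma single_power_nsmul: "Poly_Mapping.single t (1::int) ^ n = Poly_Mapping.single (nsmul n t) 1"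
  by (induction n) (auto simp: nsmul_Suc mult_single add.commute)

context transitive_extension
begin

definition invariant_map :: "('h \<Rightarrow>\<^sub>0 int) \<Rightarrow> bool" where
  "invariant_map f \<longleftrightarrow> (\<forall>g\<in>stab. \<forall>y. Poly_Mapping.lookup f (g y) = Poly_Mapping.lookup f y)"

lemma invariant_map_orb:
  assumes "invariant_map f" "y \<in> orb x"
  shows "Poly_Mapping.lookup f y = Poly_Mapping.lookup f x"
  using assms by (auto simp: invariant_map_def orb_iff)

text \<open>The convolution is reindexed by \<open>g\<close>: the factors only see orbits, and
  \<open>g y - g l\<close> lies in the orbit of \<open>y - l\<close>.\<close>

lemma invariant_map_times:
  assumes "invariant_map f" "invariant_map h"
  shows "invariant_map (f * h)"
  unfolding invariant_map_def
proof (intro ballI allI)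
  fix g y assume g: "g \<in> stab"
  have bij: "bij_betw g UNIV UNIV" using bij_G[OF stab_in_G[OF g]] by simp
  have "Poly_Mapping.lookup (f * h) (g y) = (\<Sum>l\<in>UNIV. Poly_Mapping.lookup f (g l) * Poly_Mapping.lookup h (g y - g l))"
    unfolding lookup_times_finite by (rule sum.reindex_bij_betw[OF bij, symmetric])
  also have "\<dots> = (\<Sum>l\<in>UNIV. Poly_Mapping.lookup f l * Poly_Mapping.lookup h (y - l))"
    using invariant_map_orb[OF assms(1) stab_orb[OF g]]
      invariant_map_orb[OF assms(2) diff_in_orb[OF stab_in_G[OF g]]]
    by (intro sum.cong) simp_all
  finally show "Poly_Mapping.lookup (f * h) (g y) = Poly_Mapping.lookup (f * h) y" by (simp add: lookup_times_finite)
qed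

lemma invariant_map_power: "invariant_map f \<Longrightarrow> n > 0 \<Longrightarrow> invariant_map (f ^ n)"
proof (induction n)
  case (Suc n)
  then show ?case by (cases "n = 0") (simp_all add: invariant_map_times)
qed simp

end

context p_extension
begin

text \<open>Schur's theorem on multipliers: modulo a prime \<open>q\<close>, the \<open>q\<close>-th power of
  \<open>\<Sum>t\<in>T. t\<close> in the group ring is \<open>\<Sum>t\<in>T. q t\<close>.\<close>

lemma orb_nsmul_prime:
  assumes q: "prime q" "q \<noteq> p"
  shows "orb (nsmul q x) \<subseteq> nsmul q ` orb x"
proof
  fix y assume y: "y \<in> orb (nsmul q x)"
  define f where "f = (\<Sum>t\<in>orb x. Poly_Mapping.single t (1::int))"
  have lookup_f: "Poly_Mapping.lookup f y = (if y \<in> orb x then 1 else 0)" for y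
    by (simp add: f_def lookup_sum lookup_single when_def)
  have "invariant_map f"
    unfolding invariant_map_def lookup_f
  proof (intro ballI allI)
    fix g y assume g: "g \<in> stab"
    have "g y \<in> orb x \<longleftrightarrow> y \<in> orb x"
      using diff_orb_iff[OF stab_in_G[OF g], of y 0 x] stab_zero[OF g] by simp
    then show "(if g y \<in> orb x then 1 else 0) = (if y \<in> orb x then 1 else (0::int))" by simp
  qed
  then have "invariant_map (f ^ q)" using invariant_map_power q prime_gt_0_nat by blast
  then have eq: "Poly_Mapping.lookup (f ^ q) y = Poly_Mapping.lookup (f ^ q) (nsmul q x)" using invariant_map_orb y by blast
  obtain r where r: "f ^ q = (\<Sum>t\<in>orb x. Poly_Mapping.single t (1::int) ^ q) + of_nat q * r"
    unfolding f_def using sum_power_prime[OF q(1)] by blast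
  \<comment> \<open>Written as a repeated sum so that its coefficients can be read off.\<close>
  have "of_nat q * r = (\<Sum>i<q. r)" by simp
  then have lookup_r: "Poly_Mapping.lookup (of_nat q * r) z = int q * Poly_Mapping.lookup r z" for z
    by (simp only: lookup_sum) simp
  have "\<not> p dvd q" using q prime_p primes_dvd_imp_eq by blast
  then obtain n where n: "\<And>z::'h. nsmul n (nsmul q z) = z" by (rule nsmul_inverse) blast
  have inj: "nsmul q s = nsmul q t \<longleftrightarrow> s = t" for s t :: 'h by (metis n)
  have sum_nsmul: "Poly_Mapping.lookup (\<Sum>t\<in>orb x. Poly_Mapping.single t (1::int) ^ q) z
      = (if z \<in> nsmul q ` orb x then 1 else 0)" for z
  proof -
    have "Poly_Mapping.lookup (\<Sum>t\<in>orb x. Poly_Mapping.single t (1::int) ^ q) z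
        = int (card {t \<in> orb x. nsmul q t = z})"
      by (simp add: lookup_sum lookup_single single_power_nsmul when_def sum.If_cases Int_def eq_commute[of z])
    also have "{t \<in> orb x. nsmul q t = z} = (if z \<in> nsmul q ` orb x then {nsmul n z} else {})"
      by (auto simp: n inj)
    finally show ?thesis by simp
  qed
  \<comment> \<open>Invariance makes the coefficients of \<open>f ^ q\<close> at \<open>y\<close>
    and at \<open>q x\<close> equal, and the latter is 1 modulo \<open>q\<close>. If
    \<open>y\<close> were outside the image, \<open>q\<close> would divide -1.\<close>
  have "(if y \<in> nsmul q ` orb x then 1 else 0) - (1::int) = int q * (Poly_Mapping.lookup r (nsmul q x) - Poly_Mapping.lookup r y)"
    using eq orb_self[of x] unfolding r lookup_add lookup_r sum_nsmul by (simp add: algebra_simps)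
  moreover have "\<not> int q dvd - 1" using q(1) by (auto simp: prime_nat_iff)
  ultimately show "y \<in> nsmul q ` orb x" by (metis diff_0 dvd_triv_left)
qed

text \<open>Induction over the prime factors of \<open>m\<close>, all of which differ from
  \<open>p\<close>.\<close>

lemma orb_nsmul:
  assumes "\<not> p dvd m"
  shows "orb (nsmul m x) \<subseteq> nsmul m ` orb x"
proof -
  have "m \<noteq> 0" using assms by (metis dvd_0_right)
  then show ?thesis using assms
  proof (induction m arbitrary: x rule: prime_divisors_induct)
    case (factor q m)
    have "q \<noteq> p" "\<not> p dvd m" "m \<noteq> 0" using factor by auto
    have "orb (nsmul (q * m) x) \<subseteq> nsmul q ` orb (nsmul m x)"
      unfolding nsmul_mult using orb_nsmul_prime[of q "nsmul m x"] factor \<open>q \<noteq> p\<close> by simp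
    also have "\<dots> \<subseteq> nsmul q ` nsmul m ` orb x"
      using factor.IH[OF \<open>m \<noteq> 0\<close> \<open>\<not> p dvd m\<close>] by (rule image_mono)
    finally show ?case by (simp add: image_image nsmul_mult)
  qed (auto simp: nat_dvd_1_iff_1)
qed

end

section \<open>Many thin elements\<close>

locale indecomposable_extension = p_extension G p
  for G :: "('h::{ab_group_add,finite} \<Rightarrow> 'h) set" and p :: nat +
  assumes indecomposable: "\<lbrakk>invariant_subgroup E; invariant_subgroup F; F \<subseteq> E; E \<noteq> UNIV; F \<noteq> {0}\<rbrakk>
      \<Longrightarrow> \<exists>x. x \<notin> E \<and> \<not> F \<subseteq> rad (orb x)"
begin

abbreviation Z :: "'h set" where "Z \<equiv> thin_over {0}"

abbreviation thin_shifts :: "'h \<Rightarrow> 'h set" where "thin_shifts \<equiv> shifts {0}"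

text \<open>In permutation group terms, 0 together with \<open>x\<close> is a base of
  \<open>G\<close>.\<close>

definition has_base :: bool where
  "has_base \<longleftrightarrow> (\<exists>x. \<forall>g\<in>stab. g x = x \<longrightarrow> g = id)"

lemma invariant_Z: "invariant_subgroup Z"
  by (rule invariant_thin_over[OF invariant_trivial])

lemmas subgroup_Z = invariant_subgroupD[OF invariant_Z]

lemma subgroup_shifts: "invariant_subgroup K \<Longrightarrow> is_subgroup (shifts K x)"
  by (rule subgroupI)
     (use shifts_superset[of K x] shifts_add[of K] subgroup_zero[OF invariant_subgroupD] in blast)+

lemmas subgroup_thin_shifts = subgroup_shifts[OF invariant_trivial]

lemma thin_shifts_iff: "f \<in> thin_shifts x \<longleftrightarrow> f \<in> Z \<and> x + f \<in> orb x"
proof -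
  have "y - x - f = 0 \<longleftrightarrow> y = x + f" for y by (simp add: diff_diff_eq)
  then show ?thesis by (simp add: shifts_iff)
qed

lemma thin_shifts_subset: "thin_shifts x \<subseteq> Z"
  by (auto simp: thin_shifts_iff)

lemma invariant_in_Z: "is_subgroup L \<Longrightarrow> L \<subseteq> Z \<Longrightarrow> invariant_subgroup L"
  using invariant_between[OF invariant_trivial] subgroup_zero by blast

lemma translate_orb:
  assumes "f \<in> Z" "y \<in> orb x"
  shows "y + f \<in> orb (x + f)"
proof -
  obtain g where g: "g \<in> stab" "y = g x" using assms(2) by (auto simp: orb_iff)
  then show ?thesis using thin_trivial[OF assms(1) stab_in_G[OF g(1)], of x] stab_orb[OF g(1), of "x + f"] by simp
qed

lemma thin_shifts_orb:
  assumes "y \<in> orb x"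
  shows "thin_shifts y = thin_shifts x"
proof -
  have "f \<in> thin_shifts b" if "a \<in> orb b" "f \<in> thin_shifts a" for a b f
  proof -
    have f: "f \<in> Z" "a + f \<in> orb a" using that(2) by (auto simp: thin_shifts_iff)
    have "orb (a + f) = orb (b + f)" using orb_eq[OF translate_orb[OF f(1) that(1)]] .
    moreover have "orb (a + f) = orb b" using orb_eq[OF f(2)] orb_eq[OF that(1)] by simp
    ultimately have "b + f \<in> orb b" using orb_self[of "b + f"] by simp
    then show ?thesis using f(1) by (simp add: thin_shifts_iff)
  qed
  moreover have "x \<in> orb y" using orb_eq[OF assms] orb_self[of x] by simp
  ultimately show ?thesis using assms by auto
qed

lemma thin_shifts_translate:
  assumes z: "z \<in> Z"
  shows "thin_shifts (x + z) = thin_shifts x"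
proof -
  have "thin_shifts y \<subseteq> thin_shifts (y + z)" if "z \<in> Z" for y z
  proof
    fix f assume "f \<in> thin_shifts y"
    then have "f \<in> Z" "y + f \<in> orb y" by (auto simp: thin_shifts_iff)
    then show "f \<in> thin_shifts (y + z)"
      using translate_orb[OF that, of "y + f" y] by (simp add: thin_shifts_iff ac_simps)
  qed
  from this[OF z, of x] this[OF subgroup_minus[OF subgroup_Z z], of "x + z"] show ?thesis by simp
qed

text \<open>Shifts agree along an orbit, so a shift of \<open>x\<close> is one of every point of
  \<open>orb x\<close>. With the next lemma, \<open>thin_shifts x\<close> is the part of
  \<open>rad (orb x)\<close> in \<open>Z\<close>.\<close>

lemma thin_shifts_rad: "thin_shifts x \<subseteq> rad (orb x)"
proof
  fix f assume f: "f \<in> thin_shifts x"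
  have "s + f \<in> orb x" if "s \<in> orb x" for s
  proof -
    have "f \<in> thin_shifts s" using thin_shifts_orb[OF that] f by simp
    then show ?thesis using orb_eq[OF that] by (simp add: thin_shifts_iff)
  qed
  then show "f \<in> rad (orb x)" by (simp add: rad_iff)
qed

lemma rad_inter_Z: "rad (orb x) \<inter> Z \<subseteq> thin_shifts x"
proof
  fix f assume f: "f \<in> rad (orb x) \<inter> Z"
  then have "x + f \<in> orb x" using orb_self[of x] unfolding Int_iff rad_iff by blast
  then show "f \<in> thin_shifts x" using f by (simp add: thin_shifts_iff)
qed

text \<open>A nontrivial radical is an invariant subgroup and hence meets \<open>Z\<close>
  nontrivially, in thin shifts.\<close>

lemma rad_trivial:
  assumes "thin_shifts x = {0}"
  shows "rad (orb x) = {0}"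
proof (rule ccontr)
  assume "rad (orb x) \<noteq> {0}"
  then have "rad (orb x) \<inter> Z \<noteq> {0}" by (rule nontrivial_meets_thin[OF invariant_rad])
  moreover have "0 \<in> rad (orb x) \<inter> Z"
    using subgroup_zero[OF subgroup_Int[OF subgroup_rad subgroup_Z]] .
  ultimately show False using rad_inter_Z[of x] assms by auto
qed

lemma thin_shifts_Z:
  assumes "z \<in> Z"
  shows "thin_shifts z = {0}"
proof -
  have "orb z \<subseteq> {z}" using assms by (auto simp: thin_over_def orb_iff)
  then show ?thesis using subgroup_zero[OF subgroup_thin_shifts, of z] by (auto simp: thin_shifts_iff)
qed

lemma thin_shifts_nontrivial:
  assumes "x \<notin> Z" "x \<in> thin_over Z"
  shows "thin_shifts x \<noteq> {0}"
proof -
  obtain g where g: "g \<in> stab" "g x - x \<noteq> 0" using assms(1) by (auto simp: thin_over_def)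
  have "g x - x \<in> thin_shifts x"
    using thin_over_stab[OF assms(2) g(1)] stab_orb[OF g(1), of x] by (simp add: thin_shifts_iff)
  then show ?thesis using g(2) by auto
qed

text \<open>If \<open>orb x\<close> is a transversal of \<open>Z\<close> in \<open>x + E\<close>, then an element of the stabilizer of \<open>x\<close>
  which moves \<open>e \<in> E\<close> inside \<open>e + Z\<close> preserves the unique point of \<open>x - e + Z\<close> in \<open>orb x\<close>.\<close>

lemma transversal_fixes:
  assumes spread: "\<And>e. e \<in> E \<Longrightarrow> \<exists>t\<in>orb x. t - x - e \<in> Z" and E: "is_subgroup E"
    and triv: "thin_shifts x = {0}" and g: "g \<in> stab" "g x = x"
    and e: "e \<in> E" "g e - e \<in> Z"
  shows "g e = e"
proof -
  obtain t where t: "t \<in> orb x" "t - x - - e \<in> Z" using spread[OF subgroup_minus[OF E e(1)]] by blast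
  define z where "z = t - x - - e"
  have z: "- z \<in> Z" unfolding z_def by (rule subgroup_minus[OF subgroup_Z t(2)])
  have t_eq: "x - (e + - z) = t" by (simp add: z_def)
  have "g x - g (e + - z) \<in> orb t"
    using diff_in_orb[OF stab_in_G[OF g(1)], of x "e + - z"] unfolding t_eq .
  moreover have "g x - g (e + - z) = t + (- (g e - e))"
    unfolding t_eq[symmetric] thin_trivial[OF z stab_in_G[OF g(1)]] g(2) by (simp add: algebra_simps)
  ultimately have "- (g e - e) \<in> thin_shifts t"
    using subgroup_minus[OF subgroup_Z e(2)] by (simp add: thin_shifts_iff)
  then show ?thesis using thin_shifts_orb[OF t(1)] triv by simp
qed

lemma subgroup_stable_shifts: "is_subgroup D \<Longrightarrow> is_subgroup (stable_shifts D)"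
  using stable_shifts_superset[of D] subgroup_zero[of D] stable_shifts_add by (intro subgroupI) blast+

lemma thin_over_large:
  assumes E: "invariant_subgroup E" "E \<noteq> UNIV" "p ^ 3 \<le> card E"
  shows "thin_over E = UNIV"
proof -
  obtain z where "z \<notin> E" "z \<in> thin_over E"
    using exists_thin_over[OF E(1) invariant_UNIV] E(2) by blast
  then show ?thesis
    using E card_H thin_over_superset[OF E(1)]
    by (intro subgroup_eq_of_card[OF invariant_subgroupD[OF E(1)] subgroup_thin_over[OF E(1)]])
       (auto simp: power_eq_if)
qed

lemma subgroup_eq_UNIV:
  assumes "is_subgroup E" "p ^ 3 \<le> card E" "is_subgroup S" "E \<subseteq> S" "x \<in> S" "x \<notin> E"
  shows "S = (UNIV :: 'h set)"
  using assms card_H by (intro subgroup_eq_of_card[OF assms(1,3)]) (auto simp: power_eq_if)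

text \<open>The trivial radical makes \<open>x\<close> a stable shift of \<open>E\<close>; since
  \<open>E\<close> has index \<open>p\<close>, it generates \<open>H\<close> together with
  \<open>x\<close>.\<close>

lemma has_base_if_fixes:
  assumes E: "invariant_subgroup E" "E \<noteq> UNIV" "p ^ 3 \<le> card E"
    and x: "x \<notin> E" "thin_shifts x = {0}"
    and fixes_E: "\<And>g e. g \<in> stab \<Longrightarrow> g x = x \<Longrightarrow> e \<in> E \<Longrightarrow> g e = e"
  shows has_base
proof -
  note sgE = invariant_subgroupD[OF E(1)]
  have "x \<in> stable_shifts E"
    using stable_shiftsI[OF E(1) _ rad_trivial[OF x(2)]] thin_over_large[OF E] by simp
  then have "stable_shifts E = UNIV"
    using subgroup_eq_UNIV[OF sgE E(3) subgroup_stable_shifts[OF sgE] stable_shifts_superset[OF sgE] _ x(1)]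
    by simp
  then have "g = id" if "g \<in> stab" "g x = x" for g
    using stable_shifts_UNIV[OF sgE _ stab_in_G[OF that(1)] fixes_E[OF that]] by simp
  then show ?thesis unfolding has_base_def by blast
qed

lemma has_base_thin:
  assumes "Z = UNIV"
  shows has_base
proof -
  have "g = id" if "g \<in> stab" for g
  proof
    fix x
    have "x \<in> Z" using assms by simp
    from thin_over_stab[OF this that] show "g x = id x" by simp
  qed
  then show ?thesis by (simp add: has_base_def)
qed

section \<open>Thin quotients \<open>H / Z\<close>\<close>

definition dominated :: "'h set \<Rightarrow> 'h set" where
  "dominated L = {w. thin_shifts w \<subseteq> L}"

lemma Z_subset_dominated: "is_subgroup L \<Longrightarrow> Z \<subseteq> dominated L"
  by (auto simp: dominated_def thin_shifts_Z subgroup_zero)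

text \<open>All displacements lie in \<open>Z\<close> here, and \<open>g (y + w) - g y\<close> lies
  in the orbit of \<open>w\<close>; so adding \<open>w\<close> changes the displacement by a shift
  of \<open>w\<close>.\<close>

lemma displacement_diff:
  assumes "thin_over Z = UNIV" "g \<in> stab"
  shows "(g (y + w) - (y + w)) - (g y - y) \<in> thin_shifts w"
proof -
  have disp: "g u - u \<in> Z" for u using thin_over_stab[OF _ assms(2), of u Z] assms(1) by simp
  have "g (y + w) - g y \<in> orb w" using diff_in_orb[OF stab_in_G[OF assms(2)], of "y + w" y] by simp
  moreover have "g (y + w) - g y = w + ((g (y + w) - (y + w)) - (g y - y))" by (simp add: algebra_simps)
  ultimately have "w + ((g (y + w) - (y + w)) - (g y - y)) \<in> orb w" by (simp only:)
  then show ?thesis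
    unfolding thin_shifts_iff using subgroup_diff[OF subgroup_Z disp disp] by (rule conjI[rotated])
qed

lemma subgroup_dominated:
  assumes thin: "thin_over Z = UNIV" and L: "is_subgroup L"
  shows "is_subgroup (dominated L)"
proof (rule subgroupI)
  show "0 \<in> dominated L" using Z_subset_dominated[OF L] subgroup_zero[OF subgroup_Z] by blast
  fix x y assume xy: "x \<in> dominated L" "y \<in> dominated L"
  have "f \<in> L" if f: "f \<in> thin_shifts (x + y)" for f
  proof -
    obtain g where g: "g \<in> stab" "x + y + f = g (x + y)"
      using f by (auto simp: thin_shifts_iff orb_iff[of "x + y + f"])
    have "(g (x + y) - (x + y)) - (g x - x) \<in> L"
      using displacement_diff[OF thin g(1), of x y] xy(2) by (auto simp: dominated_def)
    moreover have "g x - x \<in> L"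
      using displacement_diff[OF thin g(1), of 0 x] stab_zero[OF g(1)] xy(1) by (auto simp: dominated_def)
    ultimately have "(g (x + y) - (x + y)) - (g x - x) + (g x - x) \<in> L" by (rule subgroup_add[OF L])
    then have "g (x + y) - (x + y) \<in> L" by (simp only: diff_add_cancel)
    moreover have "g (x + y) - (x + y) = f" using g(2)[symmetric] by simp
    ultimately show ?thesis by (simp only:)
  qed
  then show "x + y \<in> dominated L" by (auto simp: dominated_def)
qed

text \<open>A point \<open>y\<close> outside \<open>Z\<close> generates \<open>H\<close> together
  with \<open>Z\<close>, so \<open>thin_shifts y\<close> dominates every point. Hence the shift
  groups outside \<open>Z\<close> coincide, and they yield a wreath decomposition over
  \<open>Z\<close>.\<close>

lemma card_Z_not_p3: "card Z \<noteq> p ^ 3"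
proof
  assume card: "card Z = p ^ 3"
  have "Z \<noteq> UNIV" using card card_H p_gt_1 by auto
  then obtain x where x: "x \<notin> Z" by blast
  have thin: "thin_over Z = UNIV" using thin_over_large[OF invariant_Z \<open>Z \<noteq> UNIV\<close>] card by simp
  have "thin_shifts x \<subseteq> rad (orb y)" if y: "y \<notin> Z" for y
  proof -
    have "y \<in> dominated (thin_shifts y)" by (simp add: dominated_def)
    then have "dominated (thin_shifts y) = UNIV"
      using subgroup_eq_UNIV[OF subgroup_Z _ subgroup_dominated[OF thin subgroup_thin_shifts]
          Z_subset_dominated[OF subgroup_thin_shifts] _ y] card by simp
    then have "thin_shifts x \<subseteq> thin_shifts y" by (auto simp: dominated_def)
    then show ?thesis using thin_shifts_rad by blast
  qed
  moreover have "invariant_subgroup (thin_shifts x)"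
    using invariant_in_Z[OF subgroup_thin_shifts thin_shifts_subset] .
  moreover have "thin_shifts x \<noteq> {0}" using thin_shifts_nontrivial[OF x] thin by simp
  ultimately show False
    using indecomposable[OF invariant_Z _ thin_shifts_subset \<open>Z \<noteq> UNIV\<close>] by blast
qed

lemma card_subgroup_of_p2:
  assumes "card Z = p ^ 2" "is_subgroup F" "F \<subset> Z" "F \<noteq> {0}"
  shows "card F = p"
proof -
  have "{0} \<subset> F" using assms(2,4) subgroup_zero by blast
  then have "p dvd card F" using card_psubset_dvd[OF subgroup_trivial assms(2)] by simp
  moreover have "p * card F dvd p * p"
    using card_psubset_dvd[OF assms(2) subgroup_Z assms(3)] assms(1) by (simp add: power2_eq_square)
  then have "card F dvd p" using p_gt_1 by simp
  ultimately show ?thesis by (rule dvd_antisym[rotated])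
qed

text \<open>A stabilizer element \<open>g\<close> moves each coset \<open>y + Z\<close> by a
  translation \<open>c y\<close>. With three distinct lines of \<open>Z\<close> as shift groups of
  \<open>y1\<close>, \<open>y2\<close>, \<open>y3\<close>, and \<open>y3\<close> split as
  \<open>a1 + a2\<close>, fixing \<open>a1\<close> forces \<open>c\<close> to vanish.\<close>

lemma has_base_p2_thin:
  assumes card: "card Z = p ^ 2" and thin: "thin_over Z = UNIV"
  shows has_base
proof -
  have Z_ne: "Z \<noteq> UNIV" using card card_H p_gt_1 by auto
  have inv: "invariant_subgroup E" if "is_subgroup E" "Z \<subseteq> E" for E
    using invariant_between[OF invariant_Z that] thin by simp
  note sg_dom = subgroup_dominated[OF thin subgroup_thin_shifts]
    and Z_dom = Z_subset_dominated[OF subgroup_thin_shifts]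
  \<comment> \<open>Indecomposability gives a point outside \<open>E\<close> whose shifts do not
    contain \<open>L\<close>; they form a proper nontrivial subgroup of \<open>Z\<close>.\<close>
  have line: "\<exists>y. y \<notin> E \<and> \<not> L \<subseteq> thin_shifts y \<and> card (thin_shifts y) = p"
    if E: "is_subgroup E" "Z \<subseteq> E" "E \<noteq> UNIV" and L: "is_subgroup L" "L \<subseteq> Z" "L \<noteq> {0}" for E L
  proof -
    obtain y where y: "y \<notin> E" "\<not> L \<subseteq> rad (orb y)"
      using indecomposable[OF inv[OF E(1,2)] invariant_in_Z[OF L(1,2)] _ E(3) L(3)] E L by blast
    have "\<not> L \<subseteq> thin_shifts y" using y(2) thin_shifts_rad by blast
    moreover have "card (thin_shifts y) = p"
      using thin_shifts_nontrivial[of y] thin y(1) E(2) calculation L(2) thin_shifts_subset[of y]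
      by (intro card_subgroup_of_p2[OF card subgroup_thin_shifts]) auto
    ultimately show ?thesis using y(1) by blast
  qed
  \<comment> \<open>If one line dominated every point, all shift groups outside \<open>Z\<close>
    would equal it, contrary to \<open>line\<close> for \<open>Z\<close>.\<close>
  have dom_ne: "dominated (thin_shifts u) \<noteq> UNIV" if u: "card (thin_shifts u) = p" for u
  proof
    let ?L = "thin_shifts u"
    have L_ne: "?L \<noteq> {0}" using u p_gt_1 by auto
    assume all: "dominated ?L = UNIV"
    obtain y where y: "y \<notin> Z" "\<not> ?L \<subseteq> thin_shifts y"
      using line[OF subgroup_Z order_refl Z_ne subgroup_thin_shifts thin_shifts_subset L_ne] by blast
    have "thin_shifts y \<subseteq> ?L" using all by (auto simp: dominated_def)
    moreover have "{0} \<subset> thin_shifts y"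
      using thin_shifts_nontrivial[OF y(1)] thin subgroup_zero[OF subgroup_thin_shifts, of y] by auto
    ultimately have "thin_shifts y = ?L"
      using u by (intro subgroup_eq_of_card[OF subgroup_trivial subgroup_thin_shifts]) auto
    then show False using y(2) by simp
  qed
  have "Z \<noteq> {0}" using card one_less_power[OF p_gt_1, of 2] by auto
  \<comment> \<open>Choosing \<open>y2\<close> not dominated by the first line makes the second line
    different; \<open>y3\<close> is chosen so that its line differs from both.\<close>
  obtain y1 where y1: "y1 \<notin> Z" "card (thin_shifts y1) = p"
    using line[OF subgroup_Z order_refl Z_ne subgroup_Z order_refl \<open>Z \<noteq> {0}\<close>] by blast
  obtain y2 where y2: "y2 \<notin> dominated (thin_shifts y1)" "card (thin_shifts y2) = p"
    using line[OF sg_dom Z_dom dom_ne[OF y1(2)] subgroup_Z order_refl \<open>Z \<noteq> {0}\<close>] by blast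
  have "thin_shifts y1 \<noteq> {0}" using y1(2) p_gt_1 by auto
  then obtain y3 where y3: "y3 \<notin> dominated (thin_shifts y2)" "card (thin_shifts y3) = p"
      "\<not> thin_shifts y1 \<subseteq> thin_shifts y3"
    using line[OF sg_dom Z_dom dom_ne[OF y2(2)] subgroup_thin_shifts thin_shifts_subset] by metis
  define L1 L2 L3 where L: "L1 = thin_shifts y1" "L2 = thin_shifts y2" "L3 = thin_shifts y3"
  note sgL = subgroup_thin_shifts[of y1, folded L] subgroup_thin_shifts[of y2, folded L]
    subgroup_thin_shifts[of y3, folded L]
  have "\<not> L2 \<subseteq> L1" "\<not> L3 \<subseteq> L2" "\<not> L1 \<subseteq> L3" using y2 y3 by (auto simp: L dominated_def)
  then have int: "L1 \<inter> L2 = {0}" "L2 \<inter> L3 = {0}" "L1 \<inter> L3 = {0}"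
    using subgroup_Int_trivial sgL y1(2) y2(2) y3(2) L by (metis Int_commute)+
  define S1 S2 where S: "S1 = dominated L1" "S2 = dominated L2"
  have sgS: "is_subgroup S1" "is_subgroup S2" unfolding S L by (rule sg_dom)+
  have ZS: "Z \<subseteq> S1" "Z \<subseteq> S2" unfolding S L by (rule Z_dom)+
  have S_ne: "S1 \<noteq> UNIV" "S2 \<noteq> UNIV" unfolding S L using dom_ne y1(2) y2(2) by auto
  have y_S: "y1 \<in> S1" "y2 \<in> S2" by (auto simp: S L dominated_def)
  have "y1 \<notin> S2"
  proof
    assume "y1 \<in> S2"
    then have "L1 \<subseteq> L1 \<inter> L2" by (auto simp: S L dominated_def)
    then have "card L1 \<le> card {0::'h}" unfolding int by (intro card_mono) auto
    then show False using y1(2) p_gt_1 by (simp add: L)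
  qed
  have "y2 \<notin> Z" using y2(1) Z_dom by blast
  have card_le: "card S \<le> p * card Z" if "is_subgroup S" "S \<noteq> UNIV" for S :: "'h set"
  proof -
    have "p * card S dvd p * p ^ 3"
      using card_psubset_dvd[OF that(1) subgroup_UNIV] that(2) card_H by (auto simp: power_eq_if)
    then have "card S dvd p ^ 3" using p_gt_1 by simp
    then show ?thesis using card p_gt_1 by (auto dest!: dvd_imp_le simp: power_eq_if)
  qed
  have "p * card Z dvd card S2"
    using card_psubset_dvd[OF subgroup_Z sgS(2)] ZS(2) y_S(2) \<open>y2 \<notin> Z\<close> by blast
  moreover have "0 < card S2" using y_S(2) by (auto simp: card_gt_0_iff)
  ultimately have card_S2: "p ^ 3 \<le> card S2" using card by (auto dest!: dvd_imp_le simp: power_eq_if)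
  \<comment> \<open>\<open>S2\<close> has index \<open>p\<close> and \<open>y1\<close> lies outside
    it, so the sum of \<open>S1\<close> and \<open>S2\<close> is \<open>H\<close>.\<close>
  let ?S = "{s1 + s2 |s1 s2. s1 \<in> S1 \<and> s2 \<in> S2}"
  have zero_S: "0 \<in> S1" "0 \<in> S2" using sgS subgroup_zero by auto
  have sum_UNIV: "?S = UNIV"
  proof (rule subgroup_eq_UNIV[OF sgS(2) card_S2])
    show "is_subgroup ?S"
    proof (rule subgroupI)
      show "0 \<in> ?S" using zero_S by force
      fix x y assume "x \<in> ?S" "y \<in> ?S"
      then obtain a b c d where "x = a + b" "y = c + d" "a \<in> S1" "c \<in> S1" "b \<in> S2" "d \<in> S2" by auto
      moreover from this have "a + c \<in> S1" "b + d \<in> S2" using subgroup_add sgS by auto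
      moreover have "a + b + (c + d) = (a + c) + (b + d)" by (simp add: ac_simps)
      ultimately show "x + y \<in> ?S" by blast
    qed
    show "S2 \<subseteq> ?S" using zero_S by force
    show "y1 \<in> ?S" using zero_S y_S(1) by force
  qed fact
  then obtain a1 a2 where a: "y3 = a1 + a2" "a1 \<in> S1" "a2 \<in> S2" by blast
  have "y3 \<notin> S1"
  proof
    assume "y3 \<in> S1"
    then have "L3 \<subseteq> L1 \<inter> L3" by (auto simp: S L dominated_def)
    then have "card L3 \<le> card {0::'h}" unfolding int by (intro card_mono) auto
    then show False using y3(2) p_gt_1 by (simp add: L)
  qed
  have "y3 \<notin> S2" using y3(1) by (simp add: S L)
  have a_Z: "a1 \<notin> Z" "a2 \<notin> Z"
    using \<open>y3 \<notin> S1\<close> \<open>y3 \<notin> S2\<close> a ZS subgroup_add[OF sgS(1), of a1 a2] subgroup_add[OF sgS(2), of a1 a2] by auto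
  have "g = id" if g: "g \<in> stab" "g a1 = a1" for g
  proof -
    define c where "c = (\<lambda>y. g y - y)"
    have c_diff: "c (y + w) - c y \<in> thin_shifts w" for y w
      using displacement_diff[OF thin g(1)] by (simp add: c_def)
    have c0: "c 0 = 0" using stab_zero[OF g(1)] by (simp add: c_def)
    have c_Z: "c (y + z) = c y" if "z \<in> Z" for y z
      using thin_trivial[OF that stab_in_G[OF g(1)], of y] by (simp add: c_def)
    have d1: "c (y + w) - c y \<in> L1" if "w \<in> S1" for y w
      using c_diff[of y w] that by (auto simp: S dominated_def)
    have d2: "c (y + w) - c y \<in> L2" if "w \<in> S2" for y w
      using c_diff[of y w] that by (auto simp: S dominated_def)
    \<comment> \<open>The defect of additivity lies in \<open>L2\<close> if \<open>s2\<close> is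
      added last and in \<open>L1\<close> if \<open>s1\<close> is; these meet trivially.\<close>
    have c_add: "c (s1 + s2) = c s1 + c s2" if s: "s1 \<in> S1" "s2 \<in> S2" for s1 s2
    proof -
      have "c (s1 + s2) - c s1 - c s2 \<in> L2"
        using subgroup_diff[OF sgL(2) d2[OF s(2), of s1] d2[OF s(2), of 0]] c0 by simp
      moreover have "c (s2 + s1) - c s2 - c s1 \<in> L1"
        using subgroup_diff[OF sgL(1) d1[OF s(1), of s2] d1[OF s(1), of 0]] c0 by simp
      ultimately have "c (s1 + s2) - c s1 - c s2 \<in> L1 \<inter> L2" by (simp add: algebra_simps)
      then show ?thesis unfolding int by (simp add: algebra_simps)
    qed
    have c_a1: "c a1 = 0" using g(2) by (simp add: c_def)
    have "c y3 = c a2" using c_add[OF a(2,3)] c_a1 a(1) by simp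
    moreover have "c y3 \<in> L3" using c_diff[of 0 y3] c0 by (simp add: L)
    moreover have "c a2 \<in> L2" using d2[OF a(3), of 0] c0 by simp
    ultimately have "c a2 \<in> L2 \<inter> L3" by simp
    then have c_a2: "c a2 = 0" unfolding int by simp
    \<comment> \<open>Adding \<open>y3\<close> to \<open>s\<close> has the same effect on
      \<open>c\<close> as adding \<open>a1\<close>, so the change lies in both \<open>L3\<close> and
      \<open>L1\<close>.\<close>
    have step1: "c (s + a1) = c s" if s: "s \<in> S1" for s
    proof -
      have "c (s + y3) = c (s + a1)"
        using c_add[OF subgroup_add[OF sgS(1) s a(2)] a(3)] c_a2 a(1) by (simp add: add.assoc)
      then have "c (s + a1) - c s \<in> L3" using c_diff[of s y3] by (simp add: L)
      then have "c (s + a1) - c s \<in> L1 \<inter> L3" using d1[OF a(2), of s] by simp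
      then show ?thesis unfolding int by simp
    qed
    have step2: "c (s + a2) = c s" if s: "s \<in> S2" for s
    proof -
      have "s + y3 = a1 + (s + a2)" using a(1) by (simp add: ac_simps)
      then have "c (s + y3) = c (a1 + (s + a2))" by (simp only:)
      then have "c (s + y3) = c (s + a2)"
        using c_add[OF a(2) subgroup_add[OF sgS(2) s a(3)]] c_a1 by simp
      then have "c (s + a2) - c s \<in> L3" using c_diff[of s y3] by (simp add: L)
      then have "c (s + a2) - c s \<in> L2 \<inter> L3" using d2[OF a(3), of s] by simp
      then show ?thesis unfolding int by simp
    qed
    \<comment> \<open>The periods of \<open>c\<close> on \<open>T\<close> form a subgroup containing
      \<open>Z\<close> and \<open>b\<close>; the order of \<open>T\<close> leaves room only for
      \<open>T\<close> itself.\<close>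
    have vanish: "c s = 0" if T: "is_subgroup T" "Z \<subseteq> T" "T \<noteq> UNIV" and b: "b \<in> T" "b \<notin> Z"
      and step: "\<And>s. s \<in> T \<Longrightarrow> c (s + b) = c s" and s: "s \<in> T" for T b s
    proof -
      let ?P = "{u \<in> T. \<forall>s\<in>T. c (s + u) = c s}"
      have "?P = T"
      proof (rule subgroup_eq_of_card[OF subgroup_Z])
        show "is_subgroup ?P"
        proof (rule subgroupI)
          show "0 \<in> ?P" using subgroup_zero[OF T(1)] by simp
          fix u v assume u: "u \<in> ?P" and v: "v \<in> ?P"
          have "c (s + (u + v)) = c s" if "s \<in> T" for s
          proof -
            have "c (s + u + v) = c (s + u)" using v subgroup_add[OF T(1) that, of u] u by blast
            then show ?thesis using u that by (simp add: add.assoc)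
          qed
          then show "u + v \<in> ?P" using subgroup_add[OF T(1)] u v by blast
        qed
        show "Z \<subset> ?P" using T(2) c_Z b step by blast
        show "card T \<le> p * card Z" using card_le[OF T(1,3)] .
      qed blast
      then have "c (0 + s) = c 0" using s subgroup_zero[OF T(1)] by blast
      then show ?thesis using c0 by simp
    qed
    have "c y = 0" for y
    proof -
      obtain s1 s2 where "y = s1 + s2" "s1 \<in> S1" "s2 \<in> S2" using sum_UNIV by blast
      then show ?thesis
        using c_add vanish[OF sgS(1) ZS(1) S_ne(1) a(2) a_Z(1) step1]
          vanish[OF sgS(2) ZS(2) S_ne(2) a(3) a_Z(2) step2] by simp
    qed
    then show "g = id" by (auto simp: c_def)
  qed
  then show ?thesis unfolding has_base_def by blast
qed

text \<open>Here \<open>E\<close> has index \<open>p\<close>, and an orbit outside \<open>E\<close>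
  meets every coset of \<open>Z\<close> in its coset of \<open>E\<close>. Either some point outside
  \<open>E\<close> has trivial shifts and the transversal argument applies, or multipliers make all
  shift groups outside \<open>E\<close> equal, against indecomposability.\<close>

lemma has_base_p2_not_thin:
  assumes card: "card Z = p ^ 2" and not_thin: "thin_over Z \<noteq> UNIV"
  shows has_base
proof -
  define E where "E = thin_over Z"
  have E: "invariant_subgroup E" unfolding E_def by (rule invariant_thin_over[OF invariant_Z])
  note sgE = invariant_subgroupD[OF E]
  have ZE: "Z \<subseteq> E" unfolding E_def by (rule thin_over_superset[OF invariant_Z])
  have E_ne: "E \<noteq> UNIV" using not_thin by (simp add: E_def)
  have "Z \<noteq> UNIV" using ZE E_ne by blast
  then obtain z where "z \<notin> Z" "z \<in> E"
    using exists_thin_over[OF invariant_Z invariant_UNIV] unfolding E_def by blast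
  then have "p * card Z dvd card E" using card_psubset_dvd[OF subgroup_Z sgE] ZE by blast
  moreover have "0 < card E" using subgroup_zero[OF sgE] by (auto simp: card_gt_0_iff)
  ultimately have card_E: "p ^ 3 \<le> card E" using card by (auto dest!: dvd_imp_le simp: power_eq_if)
  have "card E dvd p ^ 3"
    using card_psubset_dvd[OF sgE subgroup_UNIV] E_ne card_H p_gt_1 by (auto simp: power_eq_if)
  then have card_E_le: "card E \<le> p * card Z" using card p_gt_1 by (auto dest!: dvd_imp_le simp: power_eq_if)
  have thin_E: "thin_over E = UNIV" using thin_over_large[OF E E_ne card_E] .
  \<comment> \<open>A displacement outside \<open>Z\<close> makes \<open>shifts Z x\<close> strictly
    larger than \<open>Z\<close>, hence all of \<open>E\<close>.\<close>
  have spread: "\<exists>t\<in>orb x. t - x - e \<in> Z" if x: "x \<notin> E" and e: "e \<in> E" for x e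
  proof -
    obtain g where g: "g \<in> stab" "g x - x \<notin> Z" using x by (auto simp: E_def thin_over_def)
    have "g x - x \<in> E" using thin_over_stab[OF _ g(1), of x E] thin_E by simp
    then have "g x - x \<in> shifts Z x"
      using stab_orb[OF g(1), of x] subgroup_zero[OF subgroup_Z]
      by (auto simp: shifts_iff E_def intro!: bexI[of _ "g x"])
    then have "shifts Z x = E"
      using g(2) shifts_superset[OF invariant_Z, of x] card_E_le
      by (intro subgroup_eq_of_card[OF subgroup_Z subgroup_shifts[OF invariant_Z]])
         (auto simp: shifts_iff E_def)
    then show ?thesis using e by (auto simp: shifts_iff)
  qed
  show ?thesis
  proof (cases "\<exists>x. x \<notin> E \<and> thin_shifts x = {0}")
    case True
    then obtain x where x: "x \<notin> E" "thin_shifts x = {0}" by blast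
    show ?thesis
    proof (rule has_base_if_fixes[OF E E_ne card_E x])
      fix g e assume g: "g \<in> stab" "g x = x" and e: "e \<in> E"
      show "g e = e"
        using transversal_fixes[OF spread[OF x(1)] sgE x(2) g e] thin_over_stab[of e Z, OF _ g(1)] e
        by (simp add: E_def)
    qed
  next
    case False
    \<comment> \<open>Modulo \<open>E\<close>, \<open>a\<close> is a multiple \<open>m b\<close>. By
      \<open>spread\<close> its shifts are those of \<open>m b\<close>, and Schur's theorem carries
      them back to shifts of \<open>b\<close>.\<close>
    have sub: "thin_shifts a \<subseteq> thin_shifts b" if a: "a \<notin> E" and b: "b \<notin> E" for a b
    proof -
      have "adjoin E b = UNIV"
        using subgroup_eq_UNIV[OF sgE card_E subgroup_adjoin[OF sgE] adjoin_superset adjoin_self[OF sgE] b] .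
      then obtain m where m: "a - nsmul m b \<in> E" by (auto simp: adjoin_def)
      have "\<not> p dvd m"
      proof
        assume "p dvd m"
        then have "nsmul m b = 0" by (auto simp: mult.commute[of p] nsmul_mult exponent elim!: dvdE)
        then show False using m a by simp
      qed
      then obtain n where n: "\<And>u::'h. nsmul n (nsmul m u) = u" by (rule nsmul_inverse) blast
      have mb: "nsmul m b \<notin> E"
      proof
        assume "nsmul m b \<in> E"
        from subgroup_add[OF sgE m this] a show False by simp
      qed
      obtain t where t: "t \<in> orb (nsmul m b)" "t - nsmul m b - (a - nsmul m b) \<in> Z"
        using spread[OF mb m] by blast
      have "a + (t - a) = t" by simp
      moreover have "t - a \<in> Z" using t(2) by simp
      ultimately have eq: "thin_shifts a = thin_shifts (nsmul m b)"
        using thin_shifts_translate[of "t - a" a] thin_shifts_orb[OF t(1)] by simp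
      show ?thesis
      proof
        fix r assume "r \<in> thin_shifts a"
        then have r: "r \<in> Z" "nsmul m b + r \<in> orb (nsmul m b)" using eq by (auto simp: thin_shifts_iff)
        then obtain u where u: "u \<in> orb b" "nsmul m b + r = nsmul m u"
          using orb_nsmul[OF \<open>\<not> p dvd m\<close>, of b] by blast
        have closed: "nsmul k v \<in> S" if "is_subgroup S" "v \<in> S" for k v and S :: "'h set"
          using nsmul_closed[of S v k] that by (simp add: is_subgroup_def)
        have "nsmul n (nsmul m b) + nsmul n r = nsmul n (nsmul m u)"
          using u(2) nsmul_distrib[of n "nsmul m b" r] by simp
        then have u_eq: "u = b + nsmul n r" unfolding n by simp
        then have "nsmul n r \<in> thin_shifts b"
          using u(1) closed[OF subgroup_Z r(1), of n] by (simp add: thin_shifts_iff)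
        then have "nsmul m (nsmul n r) \<in> thin_shifts b" by (rule closed[OF subgroup_thin_shifts])
        moreover have "nsmul m (nsmul n r) = r"
          using n[of r] by (simp add: nsmul_mult[symmetric] mult.commute)
        ultimately show "r \<in> thin_shifts b" by simp
      qed
    qed
    obtain x where x: "x \<notin> E" using E_ne by blast
    have "thin_shifts x \<noteq> {0}" using False x by blast
    then obtain y where "y \<notin> E" "\<not> thin_shifts x \<subseteq> rad (orb y)"
      using indecomposable[OF E invariant_in_Z[OF subgroup_thin_shifts thin_shifts_subset] _ E_ne, of x]
        thin_shifts_subset[of x] ZE by blast
    then show ?thesis using sub[OF x] thin_shifts_rad by blast
  qed
qed

end

section \<open>Few thin elements\<close>

context indecomposable_extension
begin

lemma Z_subset_nontrivial:
  assumes "card Z = p" "invariant_subgroup K" "K \<noteq> {0}"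
  shows "Z \<subseteq> K"
proof -
  note sgK = invariant_subgroupD[OF assms(2)]
  note sg = subgroup_Int[OF sgK subgroup_Z]
  have "{0} \<subset> K \<inter> Z" using nontrivial_meets_thin[OF assms(2,3)] subgroup_zero[OF sg] by blast
  then have "K \<inter> Z = Z"
    using assms(1) by (intro subgroup_eq_of_card[OF subgroup_trivial sg]) auto
  then show ?thesis by blast
qed

text \<open>Indecomposability gives a point whose radical does not contain \<open>Z\<close>; its
  shifts are then a proper subgroup of a group of prime order.\<close>

lemma exists_trivial_thin_shifts:
  assumes card: "card Z = p" and E: "invariant_subgroup E" "Z \<subseteq> E" "E \<noteq> UNIV"
  obtains x where "x \<notin> E" "thin_shifts x = {0}"
proof -
  have "Z \<noteq> {0}" using card p_gt_1 by auto
  then obtain x where x: "x \<notin> E" "\<not> Z \<subseteq> rad (orb x)"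
    using indecomposable[OF E(1) invariant_Z E(2,3)] by blast
  have "thin_shifts x = {0}"
  proof (rule ccontr)
    assume "thin_shifts x \<noteq> {0}"
    then have "{0} \<subset> thin_shifts x" using subgroup_zero[OF subgroup_thin_shifts] by blast
    then have "thin_shifts x = Z"
      using card thin_shifts_subset
      by (intro subgroup_eq_of_card[OF subgroup_trivial subgroup_thin_shifts]) auto
    then show False using x(2) thin_shifts_rad[of x] by simp
  qed
  then show ?thesis using that x(1) by blast
qed

lemma subset_thin_over:
  assumes D: "invariant_subgroup D" and E: "invariant_subgroup E"
    and DE: "D \<subseteq> E" "card E \<le> p * card D"
  shows "E \<subseteq> thin_over D"
proof (cases "D = E")
  case True
  then show ?thesis using thin_over_superset[OF D] by simp
next
  case False
  then obtain z where z: "z \<in> E" "z \<notin> D" "z \<in> thin_over D"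
    using exists_thin_over[OF D E] DE(1) by blast
  have "thin_over D \<inter> E = E"
    using z DE thin_over_superset[OF D]
    by (intro subgroup_eq_of_card[OF invariant_subgroupD[OF D]]
        subgroup_Int[OF subgroup_thin_over[OF D] invariant_subgroupD[OF E]]) auto
  then show ?thesis by blast
qed

text \<open>The stabilizer of \<open>x\<close> fixes \<open>D\<close> pointwise. As \<open>D\<close>
  strictly contains \<open>Z\<close>, both \<open>E\<close> and \<open>x\<close> are thin over
  \<open>D\<close>, so every point with trivial shifts is a stable shift of \<open>D\<close>; a
  proper group of stable shifts would leave such a point outside.\<close>

lemma has_base_orb_p:
  assumes card: "card Z = p" and E: "invariant_subgroup E" "Z \<subseteq> E" "card E = p ^ 3" "thin_over E = UNIV"
    and x: "x \<notin> E" "thin_shifts x = {0}" "card (orb x) = p"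
  shows has_base
proof -
  note sgE = invariant_subgroupD[OF E(1)]
  define D where "D = difference_span (orb x)"
  have D: "invariant_subgroup D" unfolding D_def by (rule invariant_difference_span)
  note sgD = invariant_subgroupD[OF D]
  have diff_D: "t - x \<in> D" if "t \<in> orb x" for t
    using difference_span.step[OF difference_span.zero that orb_self] by (simp add: D_def)
  have diff_E: "t - x \<in> E" if "t \<in> orb x" for t
    using thin_over_orb[OF E(1) _ that] E(4) by simp
  have "D \<subseteq> E"
    unfolding D_def
  proof (rule difference_span_subset[OF sgE])
    fix t t' assume "t \<in> orb x" "t' \<in> orb x"
    from subgroup_diff[OF sgE diff_E[OF this(1)] diff_E[OF this(2)]] show "t - t' \<in> E" by simp
  qed
  have not_Z: "\<not> D \<subseteq> Z"
  proof
    assume sub: "D \<subseteq> Z"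
    have "orb x \<subseteq> {x}"
    proof
      fix t assume t: "t \<in> orb x"
      then have "t - x \<in> thin_shifts x" using diff_D[OF t] sub by (auto simp: thin_shifts_iff)
      then show "t \<in> {x}" using x(2) by simp
    qed
    then have "card (orb x) \<le> 1" using card_mono[of "{x}" "orb x"] by simp
    then show False using x(3) p_gt_1 by simp
  qed
  have "D \<noteq> {0}" using not_Z subgroup_zero[OF subgroup_Z] by auto
  then have ZD: "Z \<subseteq> D" by (rule Z_subset_nontrivial[OF card D])
  have "p * card Z dvd card D" using card_psubset_dvd[OF subgroup_Z sgD] ZD not_Z by blast
  moreover have "0 < card D" using subgroup_zero[OF sgD] by (auto simp: card_gt_0_iff)
  ultimately have "p * p \<le> card D" using card by (auto dest!: dvd_imp_le)
  then have "card E \<le> p * card D" using E(3) by (simp add: power3_eq_cube)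
  then have "E \<subseteq> thin_over D" by (rule subset_thin_over[OF D E(1) \<open>D \<subseteq> E\<close>])
  moreover have "x \<in> thin_over D"
    unfolding thin_over_def using diff_D stab_orb[of _ x] by simp
  ultimately have thin_D: "thin_over D = UNIV"
    using subgroup_eq_UNIV[OF sgE _ subgroup_thin_over[OF D] _ _ x(1)] E(3) by simp
  have stableI: "y \<in> stable_shifts D" if "thin_shifts y = {0}" for y
    using stable_shiftsI[OF D _ rad_trivial[OF that]] thin_D by simp
  have "stable_shifts D = UNIV"
  proof (rule ccontr)
    assume ne: "stable_shifts D \<noteq> UNIV"
    have "invariant_subgroup (stable_shifts D)"
      using invariant_between[OF D subgroup_stable_shifts[OF sgD] stable_shifts_superset[OF sgD]] thin_D
      by simp
    then obtain y where "y \<notin> stable_shifts D" "thin_shifts y = {0}"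
      using exists_trivial_thin_shifts[OF card _ _ ne] ZD stable_shifts_superset[OF sgD] by blast
    then show False using stableI by blast
  qed
  then have "g = id" if "g \<in> stab" "g x = x" for g
    using stable_shifts_UNIV[OF sgD _ stab_in_G[OF that(1)] difference_span_fixed[OF x(3) that, folded D_def]]
    by simp
  then show ?thesis unfolding has_base_def by blast
qed

end

section \<open>Orbits that are transversals of \<open>Z\<close> in a coset of
  \<open>E\<close>\<close>

locale transversal_orbit = indecomposable_extension G p
  for G :: "('h::{ab_group_add,finite} \<Rightarrow> 'h) set" and p :: nat +
  fixes E :: "'h set" and x :: 'h
  assumes card_Z: "card Z = p" and invariant_E: "invariant_subgroup E"
    and card_E: "card E = p ^ 3" and thin_E: "thin_over E = UNIV" and Z_subset_E: "Z \<subseteq> E"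
    and x_notin_E: "x \<notin> E" and triv_x: "thin_shifts x = {0}"
    and spread: "e \<in> E \<Longrightarrow> \<exists>t\<in>orb x. t - x - e \<in> Z"
begin

lemmas subgroup_E = invariant_subgroupD[OF invariant_E]

text \<open>\<open>v - height v\<close> is the point of \<open>v + Z\<close> that lies in \<open>orb x\<close>; this makes sense for
  \<open>v \<in> x + E\<close> only.\<close>

definition height :: "'h \<Rightarrow> 'h" where
  "height v = (SOME z. z \<in> Z \<and> v - z \<in> orb x)"

lemma height:
  assumes "v - x \<in> E"
  shows "height v \<in> Z" "v - height v \<in> orb x"
proof -
  obtain t where t: "t \<in> orb x" "t - x - (v - x) \<in> Z" using spread[OF assms] by blast
  have "v - t \<in> Z" using subgroup_minus[OF subgroup_Z t(2)] by simp
  moreover have "v - (v - t) \<in> orb x" using t(1) by simp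
  ultimately have "height v \<in> Z \<and> v - height v \<in> orb x"
    unfolding height_def using someI[of "\<lambda>z. z \<in> Z \<and> v - z \<in> orb x" "v - t"] by blast
  then show "height v \<in> Z" "v - height v \<in> orb x" by auto
qed

text \<open>Two candidates differ by a thin shift of a point of \<open>orb x\<close>, hence by 0:
  the orbit meets each coset of \<open>Z\<close> in \<open>x + E\<close> exactly once.\<close>

lemma height_eq:
  assumes "v - x \<in> E" "z \<in> Z" "v - z \<in> orb x"
  shows "height v = z"
proof -
  have "z - height v \<in> Z" using subgroup_diff[OF subgroup_Z assms(2) height(1)[OF assms(1)]] .
  moreover have "v - z + (z - height v) \<in> orb (v - z)"
    using height(2)[OF assms(1)] orb_eq[OF assms(3)] by simp
  ultimately have "z - height v \<in> thin_shifts (v - z)" by (simp add: thin_shifts_iff)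
  then show ?thesis using thin_shifts_orb[OF assms(3)] triv_x by simp
qed

lemma coset_add: "v - x \<in> E \<Longrightarrow> e \<in> E \<Longrightarrow> v + e - x \<in> E"
  using subgroup_add[OF subgroup_E, of "v - x" e] by (simp add: algebra_simps)

lemma height_add_Z:
  assumes "v - x \<in> E" "z \<in> Z"
  shows "height (v + z) = height v + z"
proof (rule height_eq)
  show "v + z - x \<in> E" using coset_add assms Z_subset_E by blast
  show "height v + z \<in> Z" using subgroup_add[OF subgroup_Z height(1)[OF assms(1)] assms(2)] .
  show "v + z - (height v + z) \<in> orb x" using height(2)[OF assms(1)] by simp
qed

lemma coset_G:
  assumes "h \<in> G" "w - y - x \<in> E"
  shows "h w - h y - x \<in> E"
proof -
  have "h w - h y - (w - y) \<in> E"
    using thin_over_orb[OF invariant_E _ diff_in_orb[OF assms(1), of w y]] thin_E by simp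
  from subgroup_add[OF subgroup_E this assms(2)] show ?thesis by simp
qed

lemma height_G:
  assumes h: "h \<in> G" and wy: "w - y - x \<in> E"
  shows "height (h w - h y) = height (w - y)"
proof (rule height_eq[OF coset_G[OF assms] height(1)[OF wy]])
  have "w - (y + height (w - y)) \<in> orb x" using height(2)[OF wy] by (simp add: diff_diff_eq)
  then have "h w - h (y + height (w - y)) \<in> orb x" by (simp only: diff_orb_iff[OF h])
  then show "h w - h y - height (w - y) \<in> orb x"
    unfolding thin_trivial[OF height(1)[OF wy] h] by (simp add: diff_diff_eq)
qed

definition D :: "'h set" where "D = thin_over Z \<inter> E"

lemma invariant_D: "invariant_subgroup D"
  unfolding D_def by (rule invariant_Int[OF invariant_thin_over[OF invariant_Z] invariant_E])

lemmas subgroup_D = invariant_subgroupD[OF invariant_D]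

lemma Z_subset_D: "Z \<subseteq> D"
  using Z_subset_E thin_over_superset[OF invariant_Z] by (simp add: D_def)

lemma D_subset_E: "D \<subseteq> E"
  by (simp add: D_def)

text \<open>Comparing heights before and after adding \<open>d\<close> to both points shows that the
  defect \<open>f\<close> agrees at \<open>w\<close> and \<open>y\<close> whenever
  \<open>w - y\<close> is in \<open>x + E\<close>. Such differences generate \<open>H\<close>, so
  \<open>f\<close> is constant.\<close>

lemma displacement_indep:
  assumes h: "h \<in> G" and d: "d \<in> D"
  shows "h (y + d) - h y - d = h d - h 0 - d"
proof -
  define f where "f = (\<lambda>y. h (y + d) - h y - d)"
  have f_Z: "f y \<in> Z" for y
    unfolding f_def using thin_overD[OF _ h, of d Z y] d by (simp add: D_def)
  have f_eq: "f w = f y" if wy: "w - y - x \<in> E" for w y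
  proof -
    have "height (h (w + d) - h (y + d)) = height (w - y)"
      using height_G[OF h, of "w + d" "y + d"] wy by simp
    moreover have "h (w + d) - h (y + d) = (h w - h y) + (f w - f y)"
      by (simp add: f_def algebra_simps)
    ultimately have "height (h w - h y) + (f w - f y) = height (w - y)"
      using height_add_Z[OF coset_G[OF h wy] subgroup_diff[OF subgroup_Z f_Z f_Z], of w y] by simp
    then show ?thesis using height_G[OF h wy] by simp
  qed
  let ?S = "{u. \<forall>y. f (y + u) = f y}"
  have "?S = UNIV"
  proof (rule subgroup_eq_UNIV[OF subgroup_E _ _ _ _ x_notin_E])
    show "p ^ 3 \<le> card E" using card_E by simp
    show "is_subgroup ?S" by (rule subgroupI) (auto simp: add.assoc[symmetric])
    have fx: "f (y + x) = f y" for y using f_eq[of "y + x" y] subgroup_zero[OF subgroup_E] by simp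
    then show "x \<in> ?S" by blast
    have "f (y + e) = f y" if e: "e \<in> E" for y e
    proof -
      have "f (y + e + x) = f y" using f_eq[of "y + e + x" y] e by simp
      then show ?thesis using fx[of "y + e"] by simp
    qed
    then show "E \<subseteq> ?S" by blast
  qed
  then have "f (0 + y) = f 0" by blast
  then show ?thesis by (simp add: f_def)
qed

lemma stab_add_D:
  assumes "h \<in> stab" "d \<in> D"
  shows "h (y + d) = h y + d + (h d - d)"
  using displacement_indep[OF stab_in_G[OF assms(1)] assms(2), of y] stab_zero[OF assms(1)]
  by (simp add: algebra_simps)

lemma displacement_Z: "h \<in> stab \<Longrightarrow> d \<in> D \<Longrightarrow> h d - d \<in> Z"
  using thin_over_stab[of d Z h] by (simp add: D_def)

definition increment :: "'h \<Rightarrow> 'h \<Rightarrow> 'h" where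
  "increment v d = height (v + d) - height v"

lemma increment_Z: "v - x \<in> E \<Longrightarrow> d \<in> D \<Longrightarrow> increment v d \<in> Z"
  unfolding increment_def using D_subset_E
  by (intro subgroup_diff[OF subgroup_Z] height(1) coset_add) auto

text \<open>\<open>h\<close> preserves heights of differences but moves \<open>w + d\<close> by the
  extra \<open>h d - d\<close> in \<open>Z\<close>, which is what the increment loses.\<close>

lemma increment_stab:
  assumes h: "h \<in> stab" and wy: "w - y - x \<in> E" and d: "d \<in> D"
  shows "increment (h w - h y) d = increment (w - y) d - (h d - d)"
proof -
  note G = stab_in_G[OF h]
  have dE: "d \<in> E" using d D_subset_E by blast
  have "w + d - y - x \<in> E" using coset_add[OF wy dE] by (simp add: algebra_simps)
  from height_G[OF G this] have "height (h (w + d) - h y) = height (w - y + d)"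
    by (simp add: algebra_simps)
  moreover have "h (w + d) - h y = (h w - h y + d) + (h d - d)"
    unfolding stab_add_D[OF h d, of w] by (simp add: algebra_simps)
  moreover have "height ((h w - h y + d) + (h d - d)) = height (h w - h y + d) + (h d - d)"
    by (rule height_add_Z[OF coset_add[OF coset_G[OF G wy] dE] displacement_Z[OF h d]])
  ultimately have "height (h w - h y + d) + (h d - d) = height (w - y + d)" by simp
  then show ?thesis
    unfolding increment_def height_G[OF G wy] by (simp add: algebra_simps)
qed

lemma increment_add_Z:
  assumes "v - x \<in> E" "z \<in> Z" "d \<in> D"
  shows "increment (v + z) d = increment v d" "increment v (d + z) = increment v d + z"
proof -
  have "d \<in> E" using assms(3) D_subset_E by blast
  from height_add_Z[OF coset_add[OF assms(1) this] assms(2)] height_add_Z[OF assms(1,2)]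
  show "increment (v + z) d = increment v d" "increment v (d + z) = increment v d + z"
    by (simp_all add: increment_def algebra_simps)
qed

lemma x_coset: "x - x \<in> E"
  using subgroup_zero[OF subgroup_E] by simp

lemma increment_zero: "increment v 0 = 0"
  by (simp add: increment_def)

lemma increment_Z_eq: "z \<in> Z \<Longrightarrow> v - x \<in> E \<Longrightarrow> increment v z = z"
  using increment_add_Z(2)[of v z 0] subgroup_zero[OF subgroup_D] by (simp add: increment_zero)

lemma increment_from_x:
  assumes "v - x \<in> E"
  obtains h where "h \<in> stab" "h x - v \<in> Z" "\<And>d. d \<in> D \<Longrightarrow> increment v d = increment x d - (h d - d)"
proof -
  obtain t where t: "t \<in> orb x" "t - x - (v - x) \<in> Z" using spread[OF assms] by blast
  then have tv: "t - v \<in> Z" by simp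
  obtain h where h: "h \<in> stab" "t = h x" using t(1) by (auto simp: orb_iff)
  have "increment v d = increment x d - (h d - d)" if d: "d \<in> D" for d
    using increment_add_Z(1)[OF assms tv d] increment_stab[OF h(1), of x 0 d] x_coset d h(2) stab_zero[OF h(1)]
    by simp
  then show ?thesis using that h tv by blast
qed

text \<open>A second difference of \<open>height\<close>: the obstruction to
  \<open>increment x\<close> being additive on \<open>D\<close>.\<close>

definition curvature :: "'h \<Rightarrow> 'h \<Rightarrow> 'h" where
  "curvature d b = increment x (d + b) - increment x d - increment x b"

text \<open>The increments at \<open>v\<close> and at \<open>x\<close> differ by a displacement
  \<open>h d - d\<close>, which is additive on \<open>D\<close> and drops out.\<close>

lemma curvature:
  assumes v: "v - x \<in> E" and d: "d \<in> D" "b \<in> D"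
  shows "increment v (d + b) - increment v d - increment v b = curvature d b"
proof -
  obtain h where h: "h \<in> stab" "\<And>d. d \<in> D \<Longrightarrow> increment v d = increment x d - (h d - d)"
    using increment_from_x[OF v] by blast
  have "h (d + b) - (d + b) = (h d - d) + (h b - b)"
    unfolding stab_add_D[OF h(1) d(2), of d] by (simp add: algebra_simps)
  then show ?thesis
    unfolding h(2)[OF d(1)] h(2)[OF d(2)] h(2)[OF subgroup_add[OF subgroup_D d]] curvature_def
    by (simp add: algebra_simps)
qed

lemma increment_shift:
  assumes v: "v - x \<in> E" and d: "d \<in> D" "b \<in> D"
  shows "increment (v + b) d = increment v d + curvature d b"
  unfolding curvature[OF assms, symmetric] by (simp add: increment_def algebra_simps)

lemma curvature_add:
  assumes d: "d \<in> D" "b \<in> D" "b' \<in> D"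
  shows "curvature d (b + b') = curvature d b + curvature d b'"
proof -
  have xb: "x + b - x \<in> E" using coset_add[OF x_coset] d D_subset_E by blast
  have "increment (x + b + b') d = increment x d + curvature d b + curvature d b'"
    using increment_shift[OF xb d(1,3)] increment_shift[OF x_coset d(1,2)] by simp
  moreover have "increment (x + (b + b')) d = increment x d + curvature d (b + b')"
    by (rule increment_shift[OF x_coset d(1) subgroup_add[OF subgroup_D d(2,3)]])
  ultimately show ?thesis by (simp add: add.assoc)
qed

lemma curvature_Z: "d \<in> D \<Longrightarrow> z \<in> Z \<Longrightarrow> curvature d z = 0"
  unfolding curvature_def by (simp add: increment_add_Z(2)[OF x_coset] increment_Z_eq[OF _ x_coset])

text \<open>With \<open>x\<close> fixed, the increment at \<open>x\<close> equals itself minus the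
  displacement of \<open>d\<close>.\<close>

lemma displacement_zero:
  assumes "h \<in> stab" "h x = x" "d \<in> D"
  shows "h d = d"
  using increment_stab[OF assms(1), of x 0 d] x_coset assms(2,3) stab_zero[OF assms(1)] by simp

lemma increment_fixes:
  assumes h: "h \<in> stab" "h x = x" and wy: "w - y - x \<in> E" and d: "d \<in> D"
  shows "increment (h w - h y) d = increment (w - y) d"
  using increment_stab[OF h(1) wy d] displacement_zero[OF h d] by simp

end

context transversal_orbit
begin

text \<open>The change of the increment when the base point moves by \<open>e\<close>. If the
  curvature vanishes, it becomes a bilinear pairing of \<open>E / D\<close> and \<open>D / Z\<close>
  with values in \<open>Z\<close>.\<close>

definition slope :: "'h \<Rightarrow> 'h \<Rightarrow> 'h" where
  "slope e d = increment (x + e) d - increment x d"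

lemma x_add_coset: "e \<in> E \<Longrightarrow> x + e - x \<in> E"
  by simp

text \<open>The chain \<open>Z\<close>, \<open>D\<close>, \<open>E\<close> is strict, so
  \<open>E / D\<close> has order \<open>p\<close> and is thin.\<close>

lemma E_subset_thin_D:
  assumes "\<not> E \<subseteq> thin_over Z"
  shows "E \<subseteq> thin_over D" "card D = p ^ 2"
proof -
  have "Z \<subset> E" using Z_subset_E thin_over_superset[OF invariant_Z] assms by blast
  then obtain z where z: "z \<in> E" "z \<notin> Z" "z \<in> thin_over Z"
    using exists_thin_over[OF invariant_Z invariant_E] by blast
  then have "Z \<subset> D" using Z_subset_D by (auto simp: D_def)
  from card_psubset_dvd[OF subgroup_Z subgroup_D this] have dvd1: "p * p dvd card D"
    using card_Z by simp
  have "D \<subset> E" using assms by (auto simp: D_def)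
  from card_psubset_dvd[OF subgroup_D subgroup_E this] have "p * card D dvd p * (p * p)"
    using card_E by (simp add: power3_eq_cube)
  then have dvd2: "card D dvd p * p" using p_gt_1 by simp
  from dvd1 dvd2 show card_D: "card D = p ^ 2" by (simp add: dvd_antisym power2_eq_square)
  show "E \<subseteq> thin_over D"
    by (rule subset_thin_over[OF invariant_D invariant_E D_subset_E])
       (simp add: card_D card_E power3_eq_cube power2_eq_square)
qed

text \<open>Since \<open>g\<close> fixes \<open>x\<close>, the increments at \<open>x - e\<close>
  and at \<open>x - g e\<close> agree; these points differ by \<open>g e - e\<close> in
  \<open>D\<close>, so the increments also differ by the curvature.\<close>

lemma curvature_displacement:
  assumes thin: "E \<subseteq> thin_over D" and g: "g \<in> stab" "g x = x" and e: "e \<in> E" and d: "d \<in> D"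
  shows "curvature d (g e - e) = 0"
proof -
  have b: "g e - e \<in> D" using thin_over_stab[OF _ g(1)] thin e by blast
  have xe: "x - e - x \<in> E" using subgroup_minus[OF subgroup_E e] by simp
  have c: "g x - g e - x \<in> E" by (rule coset_G[OF stab_in_G[OF g(1)] xe])
  have eq: "x - e = (g x - g e) + (g e - e)" using g(2) by simp
  have "increment (x - e) d = increment (g x - g e) d + curvature d (g e - e)"
    using increment_shift[OF c d b] unfolding eq[symmetric] .
  then show ?thesis using increment_fixes[OF g xe d] by simp
qed

section \<open>The flat case: increments are homomorphisms from \<open>D\<close> to
  \<open>Z\<close>\<close>

context
  assumes card_D: "card D = p ^ 2" and thin: "E \<subseteq> thin_over D"
    and flat: "\<And>d b. d \<in> D \<Longrightarrow> b \<in> D \<Longrightarrow> curvature d b = 0"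
begin

lemma increment_add:
  "v - x \<in> E \<Longrightarrow> d \<in> D \<Longrightarrow> b \<in> D \<Longrightarrow> increment v (d + b) = increment v d + increment v b"
  using curvature[of v d b] flat[of d b] by (simp add: algebra_simps)

lemma increment_minus:
  assumes "v - x \<in> E" "d \<in> D"
  shows "increment v (- d) = - increment v d"
  using increment_add[OF assms subgroup_minus[OF subgroup_D assms(2)]]
  by (simp add: increment_zero eq_neg_iff_add_eq_0 add.commute)

lemma increment_diff:
  assumes "v - x \<in> E" "d \<in> D" "b \<in> D"
  shows "increment v (d - b) = increment v d - increment v b"
  using increment_add[OF assms(1,2) subgroup_minus[OF subgroup_D assms(3)]] increment_minus[OF assms(1,3)]
  by simp

lemma increment_shift_flat:
  "v - x \<in> E \<Longrightarrow> d \<in> D \<Longrightarrow> b \<in> D \<Longrightarrow> increment (v + b) d = increment v d"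
  using increment_shift[of v d b] flat[of d b] by simp

text \<open>Some stabilizer element carries \<open>x\<close> to \<open>x + e\<close> modulo
  \<open>Z\<close> and subtracts the same displacement from the increments at \<open>x\<close> and
  at \<open>x + e'\<close>. It carries \<open>x + e'\<close> to \<open>x + e' + e\<close> up to
  \<open>D\<close>, which flat increments do not see.\<close>

lemma increment_slope:
  assumes e: "e \<in> E" "e' \<in> E" and d: "d \<in> D"
  shows "increment (x + e' + e) d = increment (x + e') d + slope e d"
proof -
  obtain h where h: "h \<in> stab" "h x - (x + e) \<in> Z"
    "\<And>d. d \<in> D \<Longrightarrow> increment (x + e) d = increment x d - (h d - d)"
    using increment_from_x[OF x_add_coset[OF e(1)]] by blast
  have slope: "slope e d = - (h d - d)" using h(3)[OF d] by (simp add: slope_def)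
  define b where "b = (h (x + e') - h x - e') + (h x - (x + e))"
  have "h (x + e') - h x - e' \<in> D" using thin_overD[OF _ stab_in_G[OF h(1)]] thin e(2) by blast
  then have b: "b \<in> D" unfolding b_def using h(2) Z_subset_D subgroup_add[OF subgroup_D] by blast
  have "x + e' + e - x \<in> E" using coset_add[OF x_add_coset[OF e(2)] e(1)] .
  then have "increment (x + e' + e + b) d = increment (x + e' + e) d"
    by (rule increment_shift_flat[OF _ d b])
  moreover have "x + e' + e + b = h (x + e')" by (simp add: b_def)
  moreover have "increment (h (x + e') - h 0) d = increment (x + e' - 0) d - (h d - d)"
    using increment_stab[OF h(1) _ d, of "x + e'" 0] e(2) by simp
  ultimately show ?thesis using slope stab_zero[OF h(1)] by simp
qed

lemma slope_add_left:
  assumes "e \<in> E" "e' \<in> E" "d \<in> D"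
  shows "slope (e + e') d = slope e d + slope e' d"
  using increment_slope[OF assms(2,1,3)] by (simp add: slope_def add.assoc algebra_simps)

lemma slope_zero_left: "slope 0 d = 0"
  by (simp add: slope_def)

lemma slope_minus_left:
  assumes "e \<in> E" "d \<in> D"
  shows "slope (- e) d = - slope e d"
  using slope_add_left[OF assms(1) subgroup_minus[OF subgroup_E assms(1)] assms(2)]
  by (simp add: slope_zero_left eq_neg_iff_add_eq_0 add.commute)

lemma slope_add_right:
  assumes "e \<in> E" "d \<in> D" "b \<in> D"
  shows "slope e (d + b) = slope e d + slope e b"
  unfolding slope_def
  using increment_add[OF x_add_coset[OF assms(1)] assms(2,3)] increment_add[OF x_coset assms(2,3)]
  by (simp add: algebra_simps)

lemma slope_D: "b \<in> D \<Longrightarrow> d \<in> D \<Longrightarrow> slope b d = 0"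
  using increment_shift_flat[OF x_coset, of d b] by (simp add: slope_def)

lemma slope_Z: "e \<in> E \<Longrightarrow> z \<in> Z \<Longrightarrow> slope e z = 0"
  using increment_Z_eq[of z x] increment_Z_eq[of z "x + e"] x_coset by (simp add: slope_def)

lemma exists_D_minus_Z: obtains d where "d \<in> D" "d \<notin> Z"
proof -
  have "D \<noteq> Z"
  proof
    assume "D = Z"
    then show False using card_Z card_D p_gt_1 by (simp add: power2_eq_square)
  qed
  then show ?thesis using that Z_subset_D by blast
qed

text \<open>A degenerate slope would make \<open>increment v\<close> independent of \<open>v\<close>, and its kernel would
  then be contained in the radical of \<open>orb x\<close>.\<close>

lemma slope_nondegenerate:
  assumes e: "e \<in> E" "e \<notin> D" and d: "d \<in> D" "slope e d = 0"
  shows "d \<in> Z"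
proof (rule ccontr)
  assume "d \<notin> Z"
  \<comment> \<open>The kernel contains \<open>Z\<close> and \<open>d\<close>, hence is
    \<open>D\<close>; the same argument in the first variable then makes the slope vanish
    identically.\<close>
  have "{b \<in> D. slope e b = 0} = D"
  proof (rule subgroup_eq_of_card[OF subgroup_Z])
    show "is_subgroup {b \<in> D. slope e b = 0}"
      using subgroup_zero[OF subgroup_D] subgroup_add[OF subgroup_D] slope_add_right[OF e(1)]
        slope_Z[OF e(1) subgroup_zero[OF subgroup_Z]]
      by (intro subgroupI) auto
    show "Z \<subset> {b \<in> D. slope e b = 0}"
      using Z_subset_D slope_Z[OF e(1)] d \<open>d \<notin> Z\<close> by blast
  qed (use card_D card_Z in \<open>auto simp: power2_eq_square\<close>)
  then have e_zero: "slope e b = 0" if "b \<in> D" for b using that by blast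
  have "{u \<in> E. \<forall>b\<in>D. slope u b = 0} = E"
  proof (rule subgroup_eq_of_card[OF subgroup_D])
    show "is_subgroup {u \<in> E. \<forall>b\<in>D. slope u b = 0}"
      using subgroup_zero[OF subgroup_E] subgroup_add[OF subgroup_E] slope_add_left slope_zero_left
      by (intro subgroupI) auto
    show "D \<subset> {u \<in> E. \<forall>b\<in>D. slope u b = 0}"
      using D_subset_E slope_D e e_zero by blast
  qed (use card_D card_E in \<open>auto simp: power2_eq_square power3_eq_cube\<close>)
  then have slope0: "slope u b = 0" if "u \<in> E" "b \<in> D" for u b using that by blast
  have inc: "increment v b = increment x b" if "v - x \<in> E" "b \<in> D" for v b
    using slope0[OF that] by (simp add: slope_def)
  \<comment> \<open>Correcting \<open>d\<close> inside \<open>Z\<close> makes its increment 0 at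
    \<open>x\<close>, hence on all of \<open>x + E\<close>; then adding \<open>k\<close> preserves
    height 0, that is, membership in \<open>orb x\<close>.\<close>
  define k where "k = d + - increment x d"
  have minus_Z: "- increment x d \<in> Z" using subgroup_minus[OF subgroup_Z increment_Z[OF x_coset d(1)]] .
  have k_D: "k \<in> D" unfolding k_def using subgroup_add[OF subgroup_D d(1)] minus_Z Z_subset_D by blast
  have "increment x k = 0" unfolding k_def using increment_add_Z(2)[OF x_coset minus_Z d(1)] by simp
  have "t + k \<in> orb x" if t: "t \<in> orb x" for t
  proof -
    have tx: "t - x \<in> E" using thin_over_orb[OF invariant_E _ t] thin_E by simp
    have "height t = 0" using height_eq[OF tx subgroup_zero[OF subgroup_Z]] t by simp
    moreover have "increment t k = 0" using inc[OF tx k_D] \<open>increment x k = 0\<close> by simp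
    ultimately have "height (t + k) = 0" by (simp add: increment_def)
    then show ?thesis using height(2)[OF coset_add[OF tx], of k] k_D D_subset_E by auto
  qed
  then have "k \<in> rad (orb x)" by (simp add: rad_iff)
  then have "k = 0" using rad_trivial[OF triv_x] by simp
  then have "d = increment x d" by (simp add: k_def)
  then show False using increment_Z[OF x_coset d(1)] \<open>d \<notin> Z\<close> by simp
qed

lemma increment_displacement:
  assumes g: "g \<in> stab" "g x = x" and wy: "w - y - x \<in> E"
    and b: "g w - g y - (w - y) = b" "b \<in> D"
  shows "increment (w - y) b = 0"
proof -
  have "g w - g y = w - y + b" using b(1)[symmetric] by simp
  then have "height (w - y + b) = height (w - y)" using height_G[OF stab_in_G[OF g(1)] wy] by simp
  then show ?thesis by (simp add: increment_def)
qed

text \<open>The equations come from the pairs \<open>(e, x)\<close>, \<open>(0, x \<plusminus> e)\<close>, \<open>(e, x \<plusminus> e)\<close>, \<open>(x, 2 x)\<close>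
  and \<open>(x \<plusminus> e, 2 x)\<close>; here \<open>a\<close>, \<open>b\<close>, \<open>b'\<close>, \<open>c\<close> are the displacements of
  \<open>e\<close>, \<open>x + e\<close>, \<open>x - e\<close>, \<open>2 x\<close>.\<close>

lemma displacement_Z_flat:
  assumes odd: "odd p" and g: "g \<in> stab" "g x = x" and e: "e \<in> E"
  shows "g e - e \<in> Z"
proof (cases "e \<in> D")
  case True
  then show ?thesis using displacement_zero[OF g] subgroup_zero[OF subgroup_Z] by simp
next
  case False
  note G = stab_in_G[OF g(1)]
  have me: "- e \<in> E" using subgroup_minus[OF subgroup_E e] .
  define a where "a = g e - e"
  define b where "b = g (x + e) - (x + e)"
  define b' where "b' = g (x - e) - (x - e)"
  define c where "c = g (x + x) - (x + x)"
  define A where "A = increment x"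
  define m where "m = slope e"
  have aD: "a \<in> D" unfolding a_def using thin_over_stab[OF _ g(1)] thin e by blast
  have "g (x + u) - g x - u \<in> D" if "u \<in> E" for u using thin_overD[OF _ G] thin that by blast
  from this[OF e] this[OF me] have bD: "b \<in> D" "b' \<in> D"
    using g(2) by (simp_all add: b_def b'_def algebra_simps)
  have c_E: "c \<in> E" unfolding c_def using thin_over_stab[OF _ g(1)] thin_E by blast
  have cosets: "x - e - x \<in> E" "x + e - x \<in> E" "x - e - e - x \<in> E"
    using me e subgroup_add[OF subgroup_E me me] by (simp_all add: algebra_simps)
  \<comment> \<open>The increments at \<open>g (x + x) - g x = x + c\<close> and at \<open>x\<close>
    agree, so \<open>slope c\<close> vanishes, which nondegeneracy allows only for \<open>c\<close>
    in \<open>D\<close>.\<close>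
  have cD: "c \<in> D"
  proof (rule ccontr)
    assume "c \<notin> D"
    obtain d where d: "d \<in> D" "d \<notin> Z" by (rule exists_D_minus_Z)
    have "g (x + x) - g x = x + c" using g(2) by (simp add: c_def algebra_simps)
    then have "slope c d = 0"
      using increment_fixes[OF g, of "x + x" x d] x_coset d(1) by (simp add: slope_def)
    then show False using slope_nondegenerate[OF c_E \<open>c \<notin> D\<close> d(1)] d(2) by blast
  qed
  have inc_m: "increment (x - e) d = A d - m d" if "d \<in> D" for d
    using slope_minus_left[OF e that] by (simp add: A_def m_def slope_def algebra_simps)
  have inc_p: "increment (x + e) d = A d + m d" for d
    by (simp add: A_def m_def slope_def)
  have inc_2m: "increment (x - e - e) d = A d - m d - m d" if "d \<in> D" for d
    using increment_slope[OF me me that] inc_m[OF that] slope_minus_left[OF e that] by (simp add: m_def)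
  note inc = increment_displacement[OF g]
  have "increment (x - e) (- a) = 0"
    using inc[of x e, OF cosets(1) _ subgroup_minus[OF subgroup_D aD]] g(2) by (simp add: a_def)
  then have "increment (x - e) a = 0" unfolding increment_minus[OF cosets(1) aD] by simp
  then have e1: "A a - m a = 0" using inc_m[OF aD] by simp
  have e2: "A b + m b = 0"
    using inc[of "x + e" 0 b] cosets(2) bD(1) inc_p stab_zero[OF g(1)] by (simp add: b_def)
  have "increment (x - e) b' = 0"
    using inc[of "x - e" 0 b'] cosets(1) bD(2) stab_zero[OF g(1)] by (simp add: b'_def)
  then have e3: "A b' - m b' = 0" using inc_m[OF bD(2)] by simp
  have "increment x (b - a) = 0"
    using inc[of "x + e" e "b - a"] x_coset subgroup_diff[OF subgroup_D bD(1) aD]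
    by (simp add: a_def b_def algebra_simps)
  then have e4: "A b - A a = 0" using increment_diff[OF x_coset bD(1) aD] by (simp add: A_def)
  have "increment (x - e - e) (b' - a) = 0"
    using inc[of "x - e" e "b' - a"] cosets(3) subgroup_diff[OF subgroup_D bD(2) aD]
    by (simp add: a_def b'_def algebra_simps)
  then have e5: "(A b' - m b' - m b') - (A a - m a - m a) = 0"
    using increment_diff[OF cosets(3) bD(2) aD] inc_2m[OF aD] inc_2m[OF bD(2)] by simp
  have "increment (x - e) (c - b) = 0"
    using inc[of "x + x" "x + e" "c - b"] cosets(1) subgroup_diff[OF subgroup_D cD bD(1)]
    by (simp add: b_def c_def algebra_simps)
  then have e7: "(A c - m c) - (A b - m b) = 0"
    using increment_diff[OF cosets(1) cD bD(1)] inc_m[OF cD] inc_m[OF bD(1)] by simp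
  have "increment x c = 0"
    using inc[of "x + x" x c] x_coset cD g(2) by (simp add: c_def algebra_simps)
  then have e6: "A c = 0" by (simp add: A_def)
  have "increment (x + e) (c - b') = 0"
    using inc[of "x + x" "x - e" "c - b'"] cosets(2) subgroup_diff[OF subgroup_D cD bD(2)]
    by (simp add: b'_def c_def algebra_simps)
  then have e8: "(A c + m c) - (A b' + m b') = 0"
    using increment_diff[OF cosets(2) cD bD(2)] inc_p by simp
  have Aa: "A a = m a" and Ab: "A b = m a" and Ab': "A b' = m b'"
    using e1 e3 e4 by simp_all
  have mb: "m b = - m a" using e2 Ab by (simp add: eq_neg_iff_add_eq_0 add.commute)
  have "m a = m b'" using e5 unfolding Aa Ab' by simp
  \<comment> \<open>The two equations comparing \<open>c\<close> with \<open>b\<close> and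
    \<open>b'\<close> give \<open>m c\<close> opposite signs; adding them leaves four times
    \<open>m a\<close>, and \<open>p\<close> is odd.\<close>
  have "- m c = m a + m a" using e7 e6 Ab mb by simp
  moreover have "m c = m a + m a" using e8 e6 Ab' \<open>m a = m b'\<close> by simp
  ultimately have "(m a + m a) + (m a + m a) = 0" by (metis add.right_inverse)
  then have "m a = 0" using double_eq_0[OF odd] by blast
  then show ?thesis
    using slope_nondegenerate[OF e False aD] by (simp add: m_def a_def)
qed

end

text \<open>The displacement lies in the kernel \<open>?N\<close> of the curvature. As
  \<open>Z\<close> has index \<open>p\<close> in \<open>D\<close>, this kernel is \<open>Z\<close>,
  or it is \<open>D\<close> and the flat case applies.\<close>

lemma displacement_thin:
  assumes odd: "odd p" and g: "g \<in> stab" "g x = x" and e: "e \<in> E"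
  shows "g e - e \<in> Z"
proof (cases "E \<subseteq> thin_over Z")
  case True
  then show ?thesis using thin_over_stab[OF _ g(1)] e by blast
next
  case False
  note thin = E_subset_thin_D(1)[OF False] and card_D = E_subset_thin_D(2)[OF False]
  let ?N = "{b \<in> D. \<forall>d\<in>D. curvature d b = 0}"
  have N: "is_subgroup ?N"
    using subgroup_zero[OF subgroup_D] subgroup_add[OF subgroup_D] curvature_add
      curvature_Z[OF _ subgroup_zero[OF subgroup_Z]]
    by (intro subgroupI) auto
  have ZN: "Z \<subseteq> ?N" using Z_subset_D curvature_Z by auto
  have disp: "g e - e \<in> ?N"
    using curvature_displacement[OF thin g e] thin_over_stab[OF _ g(1)] thin e by blast
  show ?thesis
  proof (cases "?N = Z")
    case True
    then show ?thesis using disp by simp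
  next
    case False
    have "?N = D"
      using ZN False card_D card_Z
      by (intro subgroup_eq_of_card[OF subgroup_Z N]) (auto simp: power2_eq_square)
    then have "curvature d b = 0" if "d \<in> D" "b \<in> D" for d b using that by blast
    then show ?thesis by (rule displacement_Z_flat[OF card_D thin _ odd g e])
  qed
qed

end

section \<open>Case distinction on the order of \<open>Z\<close>\<close>

context indecomposable_extension
begin

lemma has_base_orb_p2:
  assumes odd: "odd p" and card: "card Z = p"
    and E: "invariant_subgroup E" "Z \<subseteq> E" "card E = p ^ 3" "thin_over E = UNIV" "E \<noteq> UNIV"
    and x: "x \<notin> E" "thin_shifts x = {0}"
    and spread: "\<And>e. e \<in> E \<Longrightarrow> \<exists>t\<in>orb x. t - x - e \<in> Z"
  shows has_base
proof -
  interpret transversal_orbit G p E x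
    by unfold_locales (use assms in auto)
  show ?thesis
  proof (rule has_base_if_fixes[OF E(1,5) _ x])
    show "p ^ 3 \<le> card E" using E(3) by simp
    fix g e assume g: "g \<in> stab" "g x = x" and e: "e \<in> E"
    show "g e = e"
      by (rule transversal_fixes[OF spread subgroup_E x(2) g e displacement_thin[OF odd g e]])
  qed
qed

lemma UNIV_nontrivial: "(UNIV :: 'h set) \<noteq> {0}"
proof
  assume "(UNIV :: 'h set) = {0}"
  then have "card (UNIV :: 'h set) = card {0 :: 'h}" by (rule arg_cong)
  then show False using card_H one_less_power[OF p_gt_1, of 4] by simp
qed

lemma has_base_p:
  assumes odd: "odd p" and card: "card Z = p"
  shows has_base
proof -
  obtain E where E: "invariant_subgroup E" "E \<subset> UNIV" "UNIV \<subseteq> thin_over E"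
    "card (UNIV :: 'h set) = p * card E"
    using exists_maximal_invariant[OF invariant_UNIV UNIV_nontrivial] by blast
  have thin_E: "thin_over E = UNIV" using E(3) by blast
  have E_ne: "E \<noteq> UNIV" using E(2) by blast
  have card_E: "card E = p ^ 3" using E(4) card_H p_gt_1 by (simp add: power_eq_if)
  have "E \<noteq> {0}" using card_E one_less_power[OF p_gt_1, of 3] by auto
  then have ZE: "Z \<subseteq> E" by (rule Z_subset_nontrivial[OF card E(1)])
  obtain x where x: "x \<notin> E" "thin_shifts x = {0}"
    using exists_trivial_thin_shifts[OF card E(1) ZE E_ne] .
  \<comment> \<open>The orbit meets \<open>x + Z\<close> only in \<open>x\<close>, so adding
    \<open>Z\<close> multiplies its size by \<open>p\<close>; inside \<open>x + E\<close> this
    leaves at most \<open>p ^ 2\<close> points for the orbit.\<close>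
  have "{s \<in> orb x. s - x \<in> Z} = {x}"
  proof -
    have "s = x" if "s \<in> orb x" "s - x \<in> Z" for s
    proof -
      have "s - x \<in> thin_shifts x" using that by (simp add: thin_shifts_iff)
      then show ?thesis using x(2) by simp
    qed
    then show ?thesis using orb_self subgroup_zero[OF subgroup_Z] by auto
  qed
  then have card_mod: "card (orb_mod Z x) = p * card (orb x)"
    using card_orb_mod_mult[OF invariant_Z, of x] card by simp
  have sub: "orb_mod Z x \<subseteq> (\<lambda>e. x + e) ` E"
  proof
    fix y assume "y \<in> orb_mod Z x"
    then obtain t where t: "t \<in> orb x" "y - t \<in> Z" by (auto simp: orb_mod_def)
    have "t - x \<in> E" using thin_over_orb[OF E(1) _ t(1)] thin_E by simp
    from subgroup_add[OF invariant_subgroupD[OF E(1)] subsetD[OF ZE t(2)] this]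
    have "y - x \<in> E" by simp
    then show "y \<in> (\<lambda>e. x + e) ` E" by (intro image_eqI[of _ _ "y - x"]) simp_all
  qed
  have card_coset: "card ((\<lambda>e. x + e) ` E) = p ^ 3" by (simp add: card_translate card_E)
  obtain k where k: "card (orb x) = p ^ k" using card_orb by blast
  have "p * p ^ k \<le> p ^ 3" using card_mono[OF _ sub] card_mod k card_coset by simp
  then have "p ^ Suc k \<le> p ^ 3" by simp
  then have "k \<le> 2" using p_gt_1 by (simp only: power_increasing_iff)
  moreover have "k \<noteq> 0"
  proof
    assume "k = 0"
    then have one: "card (orb x) = 1" using k by simp
    have "g x - x = 0" if "g \<in> stab" for g
      using card_eq_1_imp_eq[OF one stab_orb[OF that] orb_self] by simp
    then have "x \<in> Z" by (simp add: thin_over_def)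
    then show False using x(1) ZE by blast
  qed
  ultimately consider "k = 1" | "k = 2" by linarith
  then show ?thesis
  proof cases
    case 1
    then show ?thesis using has_base_orb_p[OF card E(1) ZE card_E thin_E x] k by simp
  next
    case 2
    \<comment> \<open>With \<open>p ^ 2\<close> points the bound is attained, so
      \<open>orb x\<close> meets every coset of \<open>Z\<close> in \<open>x + E\<close>.\<close>
    then have "orb_mod Z x = (\<lambda>e. x + e) ` E"
      using card_mod k card_coset by (intro card_subset_eq[OF _ sub]) (simp_all add: power_eq_if)
    then have "\<exists>t\<in>orb x. t - x - e \<in> Z" if e: "e \<in> E" for e
    proof -
      have "x + e \<in> orb_mod Z x" using \<open>orb_mod Z x = _\<close> e by blast
      then obtain t where t: "t \<in> orb x" "x + e - t \<in> Z" by (auto simp: orb_mod_def)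
      have "t - x - e \<in> Z" using subgroup_minus[OF subgroup_Z t(2)] by (simp add: diff_diff_eq)
      then show ?thesis using t(1) by blast
    qed
    then show ?thesis by (rule has_base_orb_p2[OF odd card E(1) ZE card_E thin_E E_ne x])
  qed
qed

lemma has_base:
  assumes "odd p"
  shows has_base
proof -
  obtain i where i: "i \<le> 4" "card Z = p ^ i" using card_subgroup_power[OF subgroup_Z] by metis
  have "i \<noteq> 0"
  proof
    assume "i = 0"
    then have "card Z = 1" using i by simp
    have "Z \<noteq> {0}" using nontrivial_meets_thin[OF invariant_UNIV UNIV_nontrivial] by simp
    then show False
      using card_eq_1_imp_eq[OF \<open>card Z = 1\<close> _ subgroup_zero[OF subgroup_Z]] subgroup_zero[OF subgroup_Z]
      by blast
  qed
  with i(1) consider "i = 1" | "i = 2" | "i = 3" | "i = 4" by linarith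
  then show ?thesis
  proof cases
    case 1
    then show ?thesis using has_base_p[OF assms] i by simp
  next
    case 2
    then show ?thesis using has_base_p2_thin has_base_p2_not_thin i by blast
  next
    case 3
    then show ?thesis using card_Z_not_p3 i by blast
  next
    case 4
    then have "Z = UNIV" using i card_H by (intro card_subset_eq) auto
    then show ?thesis by (rule has_base_thin)
  qed
qed

end

section \<open>Automorphism groups of Schurian S-rings\<close>

lemma aut_cay_iff: "g \<in> aut_cay T \<Longrightarrow> g y - g x \<in> T \<longleftrightarrow> y - x \<in> T"
  and aut_cay_bij: "g \<in> aut_cay T \<Longrightarrow> bij g"
  by (auto simp: aut_cay_def)

lemma inv_aut_cay:
  assumes g: "g \<in> aut_cay T"
  shows "inv g \<in> aut_cay T"
proof -
  have "g (inv g u) = u" for u using aut_cay_bij[OF g] by (simp add: bij_def surj_f_inv_f)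
  then have "y - x \<in> T \<longleftrightarrow> inv g y - inv g x \<in> T" for x y
    using aut_cay_iff[OF g, of "inv g y" "inv g x"] by simp
  then show ?thesis using aut_cay_bij[OF g] by (simp add: aut_cay_def bij_imp_bij_inv)
qed

lemma comp_aut_cay:
  assumes "g \<in> aut_cay T" "h \<in> aut_cay T"
  shows "g \<circ> h \<in> aut_cay T"
  unfolding aut_cay_def
proof (intro CollectI conjI allI)
  show "bij (g \<circ> h)" using bij_comp[OF aut_cay_bij[OF assms(2)] aut_cay_bij[OF assms(1)]] .
  show "y - x \<in> T \<longleftrightarrow> (g \<circ> h) y - (g \<circ> h) x \<in> T" for x y
    using aut_cay_iff[OF assms(1), of "h y" "h x"] aut_cay_iff[OF assms(2), of y x] by simp
qed

lemma translation_aut_cay: "(\<lambda>x. x + h) \<in> aut_cay T" for h :: "'a::ab_group_add"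
proof -
  have "bij (\<lambda>x. x + h)" by (rule o_bij[of "\<lambda>x. x - h"]) (auto simp: comp_def)
  then show ?thesis by (simp add: aut_cay_def)
qed

text \<open>For \<open>Bs = {}\<close> the intersection in \<open>Aut_sring\<close> would be the set of all maps.\<close>

lemma is_perm_group_Aut_sring:
  assumes "Bs \<noteq> {}"
  shows "is_perm_group (Aut_sring Bs)"
  unfolding is_perm_group_def
proof (intro conjI ballI)
  obtain T where T: "T \<in> Bs" using assms by blast
  fix g assume g: "g \<in> Aut_sring Bs"
  show "bij g" by (rule aut_cay_bij[of g T]) (use g T in \<open>simp add: Aut_sring_def\<close>)
  show "inv g \<in> Aut_sring Bs" using g by (simp add: Aut_sring_def inv_aut_cay)
  fix h assume h: "h \<in> Aut_sring Bs"
  show "g \<circ> h \<in> Aut_sring Bs"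
    using g h by (simp add: Aut_sring_def comp_aut_cay)
qed (simp add: Aut_sring_def aut_cay_def)

text \<open>The group witnessing Schurity lies in the automorphism group, and conversely
  automorphisms fixing 0 preserve each basic set; so both have the same stabilizer orbits.\<close>

lemma Aut_sring_schurian:
  fixes Bs :: "'h::{ab_group_add,finite} set set"
  assumes "schurian Bs"
  shows "transitive_extension (Aut_sring Bs)"
    and "Bs = range (transitive_extension.orb (Aut_sring Bs))"
proof -
  obtain G where G: "is_perm_group G" "contains_translations G"
    "Bs = range (\<lambda>x. {g x | g. g \<in> G \<and> g 0 = 0})"
    using assms by (auto simp: schurian_def)
  interpret S: transitive_extension G by unfold_locales (use G in auto)
  have Bs: "Bs = range S.orb" unfolding G(3) S.orb_def ..
  show tr: "transitive_extension (Aut_sring Bs)"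
  proof
    show "is_perm_group (Aut_sring Bs)" by (rule is_perm_group_Aut_sring) (simp add: Bs)
    show "contains_translations (Aut_sring Bs)"
      using translation_aut_cay by (auto simp: contains_translations_def Aut_sring_def)
  qed
  interpret A: transitive_extension "Aut_sring Bs" by (rule tr)
  have sub: "g \<in> Aut_sring Bs" if g: "g \<in> G" for g
    using S.bij_G[OF g] S.diff_orb_iff[OF g] by (auto simp: Aut_sring_def aut_cay_def Bs)
  have "A.orb x = S.orb x" for x
  proof
    show "S.orb x \<subseteq> A.orb x" using sub by (auto simp: S.orb_def A.orb_def)
    show "A.orb x \<subseteq> S.orb x"
    proof
      fix y assume "y \<in> A.orb x"
      then obtain g where g: "g \<in> Aut_sring Bs" "g 0 = 0" "y = g x" by (auto simp: A.orb_def)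
      have "g \<in> aut_cay (S.orb x)" using g(1) by (auto simp: Aut_sring_def Bs)
      from aut_cay_iff[OF this, of x 0] show "y \<in> S.orb x" using g(2,3) S.orb_self[of x] by simp
    qed
  qed
  then have "A.orb = S.orb" by blast
  then show "Bs = range A.orb" using Bs by simp
qed

section \<open>Groups with the same orbits on pairs\<close>

context transitive_extension
begin

lemma invariant_imp_A_subgroup:
  assumes Bs: "Bs = range orb" and K: "invariant_subgroup K"
  shows "A_subgroup Bs K"
proof -
  have sub: "a \<in> K" if "a \<in> orb u" "b \<in> orb u" "b \<in> K" for a b u
  proof -
    have "a \<in> orb b" using orb_eq[OF that(2)] that(1) by simp
    then show ?thesis using invariant_subgroup_orb[OF K that(3)] by (rule subsetD[rotated])
  qed
  have "(\<lambda>x. if x \<in> K then (1::rat) else 0) \<in> span_bs Bs"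
    unfolding span_bs_def
  proof (intro CollectI ballI)
    fix T a b assume T: "T \<in> Bs" "a \<in> T" "b \<in> T"
    then obtain u where u: "T = orb u" unfolding Bs by (elim rangeE)
    have "a \<in> K \<longleftrightarrow> b \<in> K" using sub[of a u b] sub[of b u a] T(2,3) unfolding u by argo
    then show "(if a \<in> K then (1::rat) else 0) = (if b \<in> K then 1 else 0)" by simp
  qed
  then show ?thesis using invariant_subgroupD[OF K] by (simp add: A_subgroup_def)
qed

text \<open>The orbit of \<open>(y, w)\<close> under \<open>X\<close> is also an orbit of
  \<open>G\<close>, so elements of \<open>X\<close> preserve the orbit of the difference
  \<open>w - y\<close>.\<close>

lemma orbits2_subset:
  assumes X: "id \<in> X" "\<And>g. g \<in> X \<Longrightarrow> bij g" and eq: "orbits2 X = orbits2 (Aut_sring Bs)"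
    and Bs: "Bs = range orb" and G: "G = Aut_sring Bs"
  shows "X \<subseteq> G"
proof
  fix g assume g: "g \<in> X"
  have "g w - g y \<in> orb (w - y)" for w y
  proof -
    have "{(f y, f w) |f. f \<in> X} \<in> orbits2 X" by (auto simp: orbits2_def)
    then obtain u v where uv: "{(f y, f w) |f. f \<in> X} = {(f u, f v) |f. f \<in> G}"
      unfolding eq G[symmetric] by (auto simp: orbits2_def)
    have "(id y, id w) \<in> {(f y, f w) |f. f \<in> X}" using X(1) by blast
    then obtain h where h: "h \<in> G" "y = h u" "w = h v" unfolding uv by auto
    have "(g y, g w) \<in> {(f y, f w) |f. f \<in> X}" using g by blast
    then obtain k where k: "k \<in> G" "g y = k u" "g w = k v" unfolding uv by auto
    have "orb (g w - g y) = orb (w - y)"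
      using orb_diff_eq[OF h(1), of v u] orb_diff_eq[OF k(1), of v u] h k by simp
    then show ?thesis using orb_self[of "g w - g y"] by simp
  qed
  then have "orb (g w - g y) = orb (w - y)" for w y by (rule orb_eq)
  then have "g w - g y \<in> orb u \<longleftrightarrow> w - y \<in> orb u" for w y u by (simp only: in_orb_iff)
  then have aut: "g \<in> aut_cay (orb u)" for u using X(2)[OF g] by (simp add: aut_cay_def)
  have "g \<in> aut_cay T" if T: "T \<in> Bs" for T
  proof -
    obtain u where "T = orb u" using T by (subst (asm) Bs) (elim rangeE)
    then show ?thesis using aut by simp
  qed
  then show "g \<in> G" by (subst G) (simp add: Aut_sring_def)
qed

text \<open>If the stabilizer of \<open>0\<close> and \<open>x\<close> is trivial, an element of \<open>G\<close> is determined by the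
  image of the pair \<open>(0, x)\<close>, hence by an element of \<open>X\<close> with the same image.\<close>

lemma base_imp_eq:
  assumes base: "\<forall>g\<in>stab. g x = x \<longrightarrow> g = id"
    and X: "is_perm_group X" "X \<subseteq> G" "orbits2 X = orbits2 G"
  shows "G \<subseteq> X"
proof
  fix g assume g: "g \<in> G"
  have "{(f 0, f x) |f. f \<in> G} \<in> orbits2 G" by (auto simp: orbits2_def)
  then obtain u v where uv: "{(f 0, f x) |f. f \<in> G} = {(f u, f v) |f. f \<in> X}"
    unfolding X(3)[symmetric] by (auto simp: orbits2_def)
  have "(id 0, id x) \<in> {(f 0, f x) |f. f \<in> G}" using id_G by blast
  then obtain h where h: "h \<in> X" "h u = 0" "h v = x" unfolding uv by auto
  have "(g 0, g x) \<in> {(f 0, f x) |f. f \<in> G}" using g by blast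
  then obtain k where k: "k \<in> X" "k u = g 0" "k v = g x" unfolding uv by auto
  define f where "f = k \<circ> inv h"
  have f_X: "f \<in> X" unfolding f_def using X(1) h(1) k(1) by (auto simp: is_perm_group_def)
  have hG: "h \<in> G" using h(1) X(2) by blast
  have f0: "f 0 = g 0" and fx: "f x = g x"
    using inv_apply(1)[OF hG, of u] inv_apply(1)[OF hG, of v] h k by (simp_all add: f_def)
  have fG: "f \<in> G" using f_X X(2) by blast
  have "inv f \<circ> g \<in> stab"
    using comp_G[OF inv_G[OF fG] g] inv_apply(1)[OF fG, of 0] f0 by (simp add: stab_def)
  moreover have "(inv f \<circ> g) x = x" using inv_apply(1)[OF fG, of x] fx by simp
  ultimately have id: "inv f \<circ> g = id" using base by blast
  have "g y = f y" for y
    using inv_apply(2)[OF fG, of "g y"] fun_cong[OF id, of y] by simp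
  then have "g = f" by blast
  then show "g \<in> X" using f_X by simp
qed

end

theorem theorem4p1:
  fixes p :: nat and Bs :: "'h::{ab_group_add,finite} set set"
  assumes "prime p" and "odd p"
    and "elem_abelian_rank4 p TYPE('h)"
    and "is_p_sring p Bs"
    and "schurian Bs"
    and "\<not> decomposable Bs"
  shows "simeq_minimal Bs"
proof -
  define G where "G = Aut_sring Bs"
  interpret transitive_extension G
    unfolding G_def by (rule Aut_sring_schurian(1)[OF assms(5)])
  have Bs: "Bs = range orb"
    using Aut_sring_schurian(2)[OF assms(5)] unfolding G_def .
  interpret indecomposable_extension G p
  proof unfold_locales
    show "\<exists>k. card (orb x) = p ^ k" for x
      using assms(4) Bs by (auto simp: is_p_sring_def)
    show "\<exists>x. x \<notin> E \<and> \<not> F \<subseteq> rad (orb x)"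
      if EF: "invariant_subgroup E" "invariant_subgroup F" "F \<subseteq> E" "E \<noteq> UNIV" "F \<noteq> {0}" for E F
    proof -
      \<comment> \<open>Invariant subgroups are subgroups of the S-ring, so the wreath condition can
        only fail at a basic set outside \<open>E\<close>.\<close>
      have "\<not> is_wreath Bs E F" using assms(6) EF(4,5) by (auto simp: decomposable_def)
      then obtain T where T: "T \<in> Bs" "T \<subseteq> UNIV - E" "\<not> F \<subseteq> rad T"
        using invariant_imp_A_subgroup[OF Bs EF(1)] invariant_imp_A_subgroup[OF Bs EF(2)] EF(3)
        unfolding is_wreath_def by blast
      then obtain x where "T = orb x" using Bs by blast
      then show ?thesis using T orb_self[of x] by blast
    qed
  qed (fact assms(1,3))+
  obtain x where base: "\<forall>g\<in>stab. g x = x \<longrightarrow> g = id"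
    using has_base[OF assms(2)] unfolding has_base_def by blast
  show ?thesis
    unfolding simeq_minimal_def
  proof (intro allI impI, elim conjE)
    fix X assume X: "is_perm_group X" "orbits2 X = orbits2 (Aut_sring Bs)"
    have sub: "X \<subseteq> G"
      by (rule orbits2_subset[OF _ _ X(2) Bs G_def]) (use X(1) in \<open>auto simp: is_perm_group_def\<close>)
    moreover have "G \<subseteq> X"
      by (rule base_imp_eq[OF base X(1) sub]) (simp add: G_def X(2))
    ultimately show "X = Aut_sring Bs" unfolding G_def by (rule equalityI)
  qed
qed

end
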